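(* Let $J:\mathcal X\hookrightarrow\mathcal Y$ be the inclusion of a full reflective subcategory, with left adjoint $E\dashv J$ and unit $\iota:{\rm Id}_{\mathcal Y}\to JE$. Let $T$ and $S$ be contravariant functors forming a dual equivalence between $\mathcal A$ and $\mathcal X$, with natural isomorphisms $\eta_X:X\to TSX$ and $\varepsilon_A:A\to STA$ satisfying the triangular identities. Let $\mathcal B=\mathsf D(\mathcal A,\mathcal J_\iota,\mathcal X)$ and let $I:\mathcal A\to\mathcal B$ be the full embedding defined in the context. Then there is a dual equivalence between $\mathcal B$ and $\mathcal Y$ given by $\tilde T:\mathcal B\to\mathcal Y^{\rm op}$, $\tilde S:\mathcal Y^{\rm op}\to\mathcal B$ and natural isomorphisms $\tilde\eta:{\rm Id}_{\mathcal Y}\to\tilde T\tilde S$, $\tilde\varepsilon:{\rm Id}_{\mathcal B}\to\tilde S\tilde T$, which is a left lifting of the given one along $I$ and $J$, i.e. $\tilde TI=JT$, and satisfies $$\tilde T\tilde S={\rm Id}_{\mathcal Y},\quad\tilde\eta=1_{{\rm Id}_{\mathcal Y}},\quad\tilde T\tilde\varepsilon=1_{\tilde T},\quad\tilde\varepsilon\tilde S=1_{\tilde S}.$$ Moreover, the full embedding $I$ has a coreflector (right adjoint) $D$ with counit $\rho:ID\to{\rm Id}_{\mathcal B}$ satisfying $DI={\rm Id}_{\mathcal A}$, $\rho I=1_I$ and $D\tilde S=SE$, so that the dual equivalence $(T,S,\eta,\varepsilon)$ is a right lifting of $(\tilde T,\tilde S,\tilde\eta,\tilde\varepsilon)$ along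 $D$ and $E$. In addition to the canonical isomorphism $\gamma:IS\to\tilde SJ$, there is therefore the canonical isomorphism $\beta:E\tilde T\to TD$, determined by each of the conditions $\beta\tilde S=\eta E$ and $S\beta\circ\varepsilon D=D\tilde\varepsilon$; furthermore, $\beta$ and $\gamma$ connect $\iota$ and $\rho$ via $$J\beta\circ\iota\tilde T=\tilde T\rho,\qquad\rho\tilde S=\tilde S\iota\circ\gamma E.$$
   Context: Conventions. $T:\mathcal A\to\mathcal X^{\rm op}$ is regarded as left adjoint to $S:\mathcal X^{\rm op}\to\mathcal A$; the data are natural isomorphisms $\eta_X:X\to TSX$ in $\mathcal X$ and $\varepsilon_A:A\to STA$ in $\mathcal A$ with $T\varepsilon\circ\eta T=1_T$, $S\eta\circ\varepsilon S=1_S$ ($T,S$ treated as contravariant functors, op-notation being suppressed on transformations). Given functors connecting the categories of two such dual equivalences, one says "left lifting" if they commute with the left adjoints (here the $T$-type functors) and "right lifting" if they commute with the right adjoints (here the $S$-type functors). For the lifting $\tilde TI=JT$, the canonical isomorphism is $\gamma=\tilde SJ\eta\circ\tilde\varepsilon IS:IS\to\tilde SJ$; it is the unique one with $\tilde T\gamma\circ\tilde\eta J=J\eta$. The class $\mathcal J_\iota$ consists of all morphisms $j=\alpha\circ\iota_Y:Y\to X$ where $Y\in|\mathcal Y|$, $X\in|\mathcal X|$ and $\alpha:EY\to X$ is an isomorphism of $\mathcal X$. The category $\mathsf D(\mathcal A,\mathcal J_\iota,\mathcal X)$: objects are pairs $(A,j)$ with $A\in|\mathcal A|$ and $j:Y\to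 TA$ in $\mathcal J_\iota$; morphisms $(\varphi,f):(A,j:Y\to TA)\to(A',j':Y'\to TA')$ are pairs of $\varphi:A\to A'$ in $\mathcal A$ and $f:Y'\to Y$ in $\mathcal Y$ with $T\varphi\circ j'=j\circ f$; composition is $(\varphi',f')\circ(\varphi,f)=(\varphi'\circ\varphi,f\circ f')$, identities $(1_A,1_Y)$. The full embedding $I:\mathcal A\to\mathcal B=\mathsf D(\mathcal A,\mathcal J_\iota,\mathcal X)$ is $A\mapsto(A,1_{TA})$, $\varphi\mapsto(\varphi,T\varphi)$. *)

theory Defs
  imports Main
begin

record ('o, 'm) cat =
  Obj :: "'o set"
  Arr :: "'m set"
  Dom :: "'m \<Rightarrow> 'o"
  Cod :: "'m \<Rightarrow> 'o"
  Ide :: "'o \<Rightarrow> 'm"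
  Comp :: "'m \<Rightarrow> 'm \<Rightarrow> 'm"  (infixr "\<cdot>\<index>" 65)

definition hom :: "('o, 'm) cat \<Rightarrow> 'o \<Rightarrow> 'o \<Rightarrow> 'm set" where
  "hom C x y = {f \<in> Arr C. Dom C f = x \<and> Cod C f = y}"

locale category =
  fixes C :: "('o, 'm) cat" (structure)
  assumes Dom_in_Obj: "f \<in> Arr C \<Longrightarrow> Dom C f \<in> Obj C"
    and Cod_in_Obj: "f \<in> Arr C \<Longrightarrow> Cod C f \<in> Obj C"
    and Ide_in_hom: "x \<in> Obj C \<Longrightarrow> Ide C x \<in> hom C x x"
    and Comp_in_hom: "\<lbrakk>f \<in> hom C x y; g \<in> hom C y z\<rbrakk> \<Longrightarrow> g \<cdot> f \<in> hom C x z"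
    and Comp_Ide_right: "f \<in> hom C x y \<Longrightarrow> f \<cdot> Ide C x = f"
    and Comp_Ide_left: "f \<in> hom C x y \<Longrightarrow> Ide C y \<cdot> f = f"
    and Comp_assoc: "\<lbrakk>f \<in> hom C x y; g \<in> hom C y z; h \<in> hom C z w\<rbrakk>
      \<Longrightarrow> (h \<cdot> g) \<cdot> f = h \<cdot> (g \<cdot> f)"

definition op_cat :: "('o, 'm) cat \<Rightarrow> ('o, 'm) cat" where
  "op_cat C = \<lparr>Obj = Obj C, Arr = Arr C, Dom = Cod C, Cod = Dom C, Ide = Ide C,
     Comp = (\<lambda>g f. f \<cdot>\<^bsub>C\<^esub> g)\<rparr>"

definition is_iso :: "('o, 'm) cat \<Rightarrow> 'm \<Rightarrow> bool" where
  "is_iso C f \<longleftrightarrow> f \<in> Arr C \<and>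
     (\<exists>g \<in> hom C (Cod C f) (Dom C f).
        g \<cdot>\<^bsub>C\<^esub> f = Ide C (Dom C f) \<and> f \<cdot>\<^bsub>C\<^esub> g = Ide C (Cod C f))"

definition full_subcategory :: "('o, 'm) cat \<Rightarrow> ('o, 'm) cat \<Rightarrow> bool" where
  "full_subcategory X Y \<longleftrightarrow> category X \<and> category Y \<and> Obj X \<subseteq> Obj Y \<and>
     Arr X = {f \<in> Arr Y. Dom Y f \<in> Obj X \<and> Cod Y f \<in> Obj X} \<and>
     (\<forall>f \<in> Arr X. Dom X f = Dom Y f \<and> Cod X f = Cod Y f) \<and>
     (\<forall>x \<in> Obj X. Ide X x = Ide Y x) \<and>
     (\<forall>f \<in> Arr X. \<forall>g \<in> Arr X. Cod X f = Dom X g \<longrightarrow> g \<cdot>\<^bsub>X\<^esub> f = g \<cdot>\<^bsub>Y\<^esub> f)"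

record ('o, 'm, 'p, 'n) fctr =
  ob :: "'o \<Rightarrow> 'p"
  ar :: "'m \<Rightarrow> 'n"

locale is_functor = C: category C + D: category D
  for C :: "('o, 'm) cat" and D :: "('p, 'n) cat" +
  fixes F :: "('o, 'm, 'p, 'n) fctr"
  assumes ob_in_Obj: "x \<in> Obj C \<Longrightarrow> ob F x \<in> Obj D"
    and ar_in_hom: "f \<in> hom C x y \<Longrightarrow> ar F f \<in> hom D (ob F x) (ob F y)"
    and ar_Ide: "x \<in> Obj C \<Longrightarrow> ar F (Ide C x) = Ide D (ob F x)"
    and ar_Comp: "\<lbrakk>f \<in> hom C x y; g \<in> hom C y z\<rbrakk>
      \<Longrightarrow> ar F (g \<cdot>\<^bsub>C\<^esub> f) = ar F g \<cdot>\<^bsub>D\<^esub> ar F f"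

definition comp_fctr :: "('p, 'n, 'q, 'k) fctr \<Rightarrow> ('o, 'm, 'p, 'n) fctr \<Rightarrow> ('o, 'm, 'q, 'k) fctr"
    (infixr "\<odot>" 70) where
  "G \<odot> F = \<lparr>ob = (\<lambda>x. ob G (ob F x)), ar = (\<lambda>f. ar G (ar F f))\<rparr>"

definition id_fctr :: "('o, 'm, 'o, 'm) fctr" where
  "id_fctr = \<lparr>ob = (\<lambda>x. x), ar = (\<lambda>f. f)\<rparr>"

text \<open>A subcategory shares the object and arrow types of the ambient category, so the maps
  underlying the inclusion are those of the identity functor.\<close>

definition inclusion_fctr :: "('o, 'm, 'o, 'm) fctr" where
  "inclusion_fctr = \<lparr>ob = (\<lambda>x. x), ar = (\<lambda>f. f)\<rparr>"

text \<open>HOL functions are total; functors with domain \<open>C\<close> are compared on \<open>C\<close> only.\<close>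

definition fctr_eq :: "('o, 'm) cat \<Rightarrow> ('o, 'm, 'p, 'n) fctr \<Rightarrow> ('o, 'm, 'p, 'n) fctr \<Rightarrow> bool" where
  "fctr_eq C F G \<longleftrightarrow>
     (\<forall>x \<in> Obj C. ob F x = ob G x) \<and> (\<forall>f \<in> Arr C. ar F f = ar G f)"

definition full_embedding ::
    "('o, 'm) cat \<Rightarrow> ('p, 'n) cat \<Rightarrow> ('o, 'm, 'p, 'n) fctr \<Rightarrow> bool" where
  "full_embedding C D F \<longleftrightarrow> is_functor C D F \<and> inj_on (ob F) (Obj C) \<and>
     (\<forall>x \<in> Obj C. \<forall>y \<in> Obj C. bij_betw (ar F) (hom C x y) (hom D (ob F x) (ob F y)))"

locale nat_trans = F: is_functor C D F + G: is_functor C D G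
  for C :: "('o, 'm) cat" and D :: "('p, 'n) cat"
    and F :: "('o, 'm, 'p, 'n) fctr" and G :: "('o, 'm, 'p, 'n) fctr" +
  fixes \<tau> :: "'o \<Rightarrow> 'n"
  assumes component_in_hom: "x \<in> Obj C \<Longrightarrow> \<tau> x \<in> hom D (ob F x) (ob G x)"
    and naturality: "f \<in> hom C x y \<Longrightarrow> ar G f \<cdot>\<^bsub>D\<^esub> \<tau> x = \<tau> y \<cdot>\<^bsub>D\<^esub> ar F f"

locale nat_iso = nat_trans +
  assumes component_is_iso: "x \<in> Obj C \<Longrightarrow> is_iso D (\<tau> x)"

locale adjunction =
  L: is_functor C D L + R: is_functor D C R +
  unit: nat_trans C C id_fctr "R \<odot> L" \<eta> + counit: nat_trans D D "L \<odot> R" id_fctr \<epsilon>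
  for C :: "('o, 'm) cat" and D :: "('p, 'n) cat"
    and L :: "('o, 'm, 'p, 'n) fctr" and R :: "('p, 'n, 'o, 'm) fctr"
    and \<eta> :: "'o \<Rightarrow> 'm" and \<epsilon> :: "'p \<Rightarrow> 'n" +
  assumes triangle_left: "x \<in> Obj C \<Longrightarrow> \<epsilon> (ob L x) \<cdot>\<^bsub>D\<^esub> ar L (\<eta> x) = Ide D (ob L x)"
    and triangle_right: "y \<in> Obj D \<Longrightarrow> ar R (\<epsilon> y) \<cdot>\<^bsub>C\<^esub> \<eta> (ob R y) = Ide C (ob R y)"

text \<open>A contravariant functor from \<open>A\<close> to \<open>X\<close> is a functor from \<open>A\<close> to \<open>op_cat X\<close>.
  The components of \<open>\<eta>\<close> are arrows of \<open>X\<close>, not of \<open>op_cat X\<close>.\<close>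

locale dual_equivalence =
  T: is_functor A "op_cat X" T + S: is_functor "op_cat X" A S +
  eta: nat_iso X X id_fctr "T \<odot> S" \<eta> + eps: nat_iso A A id_fctr "S \<odot> T" \<epsilon>
  for A :: "('a, 'm) cat" and X :: "('x, 'n) cat"
    and T :: "('a, 'm, 'x, 'n) fctr" and S :: "('x, 'n, 'a, 'm) fctr"
    and \<eta> :: "'x \<Rightarrow> 'n" and \<epsilon> :: "'a \<Rightarrow> 'm" +
  assumes triangle_T: "a \<in> Obj A \<Longrightarrow> ar T (\<epsilon> a) \<cdot>\<^bsub>X\<^esub> \<eta> (ob T a) = Ide X (ob T a)"
    and triangle_S: "x \<in> Obj X \<Longrightarrow> ar S (\<eta> x) \<cdot>\<^bsub>A\<^esub> \<epsilon> (ob S x) = Ide A (ob S x)"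

definition J_iota ::
    "('x, 'n) cat \<Rightarrow> ('x, 'n) cat \<Rightarrow> ('x, 'n, 'x, 'n) fctr \<Rightarrow> ('x \<Rightarrow> 'n) \<Rightarrow> 'n set" where
  "J_iota X Y E \<iota> = {\<alpha> \<cdot>\<^bsub>Y\<^esub> \<iota> y | \<alpha> x y.
     y \<in> Obj Y \<and> x \<in> Obj X \<and> \<alpha> \<in> hom X (ob E y) x \<and> is_iso X \<alpha>}"

text \<open>A morphism \<open>(\<phi>, f)\<close> does not determine \<open>j\<close> and \<open>j'\<close>; an arrow therefore
  carries its domain and codomain: it is a triple \<open>(dom, (\<phi>, f), cod)\<close>.\<close>

definition D_cat ::
    "('a, 'm) cat \<Rightarrow> ('x, 'n) cat \<Rightarrow> ('a, 'm, 'x, 'n) fctr \<Rightarrow> 'n set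
      \<Rightarrow> ('a \<times> 'n, ('a \<times> 'n) \<times> ('m \<times> 'n) \<times> ('a \<times> 'n)) cat" where
  "D_cat A Y T \<J> =
    (let Ob = {(a, j). a \<in> Obj A \<and> j \<in> \<J> \<and> Cod Y j = ob T a} in
     \<lparr>Obj = Ob,
      Arr = {((a, j), (\<phi>, f), (a', j')) | a j \<phi> f a' j'.
               (a, j) \<in> Ob \<and> (a', j') \<in> Ob \<and>
               \<phi> \<in> hom A a a' \<and> f \<in> hom Y (Dom Y j') (Dom Y j) \<and>
               ar T \<phi> \<cdot>\<^bsub>Y\<^esub> j' = j \<cdot>\<^bsub>Y\<^esub> f},
      Dom = (\<lambda>(b, _, _). b),
      Cod = (\<lambda>(_, _, b'). b'),
      Ide = (\<lambda>(a, j). ((a, j), (Ide A a, Ide Y (Dom Y j)), (a, j))),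
      Comp = (\<lambda>(_, (\<phi>', f'), b'') (b, (\<phi>, f), _). (b, (\<phi>' \<cdot>\<^bsub>A\<^esub> \<phi>, f \<cdot>\<^bsub>Y\<^esub> f'), b''))\<rparr>)"

definition I_fctr ::
    "('a, 'm) cat \<Rightarrow> ('x, 'n) cat \<Rightarrow> ('a, 'm, 'x, 'n) fctr
      \<Rightarrow> ('a, 'm, 'a \<times> 'n, ('a \<times> 'n) \<times> ('m \<times> 'n) \<times> ('a \<times> 'n)) fctr" where
  "I_fctr A X T =
    \<lparr>ob = (\<lambda>a. (a, Ide X (ob T a))),
     ar = (\<lambda>\<phi>. ((Dom A \<phi>, Ide X (ob T (Dom A \<phi>))), (\<phi>, ar T \<phi>),
                   (Cod A \<phi>, Ide X (ob T (Cod A \<phi>)))))\<rparr>"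

end

theory Submission
  imports Defs
begin

text \<open>
  An element of \<open>J_iota X Y E \<iota>\<close> is an arrow \<open>j : y \<rightarrow> x\<close> through which \<open>x\<close> is a reflection of
  \<open>y\<close> in \<open>X\<close>. An object \<open>(a, j : y \<rightarrow> T a)\<close> of \<open>B\<close> is therefore an object \<open>y\<close> of \<open>Y\<close>
  together with an object \<open>a\<close> dual to its reflection, and \<open>y\<close> determines \<open>(a, j)\<close> up to a unique
  isomorphism over \<open>y\<close>. This is why forgetting \<open>a\<close> and \<open>j\<close> is a dual equivalence
  \<open>T' : (a, j) \<mapsto> y\<close>. An inverse is \<open>S' : y \<mapsto> (S E y, \<eta>\<^bsub>E y\<^esub> \<circ> \<iota>\<^bsub>y\<^esub>)\<close>, and with it
  \<open>T' \<circ> S'\<close> is strictly the identity.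

  All the data come from the arrow \<open>\<alpha> : E y \<rightarrow> T a\<close> of \<open>X\<close> with \<open>\<alpha> \<circ> \<iota>\<^bsub>y\<^esub> = j\<close>, which is
  unique because \<open>X\<close> is reflective (\<open>ext_unit\<close>, \<open>unit_cancel\<close>) and invertible by the choice of \<open>j\<close>
  (\<open>\<J>_ext_iso\<close>). It is the component at \<open>(a, j)\<close> of \<open>\<beta> : E T' \<rightarrow> T D\<close>, and its transpose
  \<open>S \<alpha> \<circ> \<epsilon>\<^bsub>a\<^esub>\<close> under the given duality, paired with the identity of \<open>y\<close>, is the component of
  \<open>\<epsilon>'\<close>. The functor \<open>D\<close> is the first projection, and the counit of the
  coreflection at \<open>(a, j)\<close> is \<open>(1\<^bsub>a\<^esub>, j) : (a, 1\<^bsub>T a\<^esub>) \<rightarrow> (a, j)\<close>.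

  What remains is a list of equations between arrows of \<open>B\<close>. The key to them is that \<open>T'\<close> is
  faithful (\<open>T'_faithful\<close>), so that most of them may be checked on the second components, in \<open>Y\<close>,
  where \<open>\<epsilon>'\<close> becomes an identity, \<open>\<rho>\<close> becomes \<open>j\<close> and \<open>\<gamma>\<close> becomes \<open>\<eta>\<close>.
\<close>

section \<open>Opposites, isomorphisms and composites of functors\<close>

lemma op_cat_simps [simp]:
  "Obj (op_cat C) = Obj C" "Arr (op_cat C) = Arr C" "Dom (op_cat C) = Cod C"
  "Cod (op_cat C) = Dom C" "Ide (op_cat C) = Ide C" "g \<cdot>\<^bsub>op_cat C\<^esub> f = f \<cdot>\<^bsub>C\<^esub> g"
  "hom (op_cat C) x y = hom C y x"
  by (auto simp: op_cat_def hom_def)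

lemma fctr_simps [simp]:
  "ob (G \<odot> F) x = ob G (ob F x)" "ar (G \<odot> F) f = ar G (ar F f)"
  "ob id_fctr x = x" "ar id_fctr f = f"
  "ob inclusion_fctr x = x" "ar inclusion_fctr f = f"
  by (simp_all add: comp_fctr_def id_fctr_def inclusion_fctr_def)

lemma op_cat_op_cat [simp]: "op_cat (op_cat C) = C"
  by (simp add: op_cat_def)

lemma hom_DomCod: "f \<in> hom C x y \<Longrightarrow> Dom C f = x \<and> Cod C f = y \<and> f \<in> Arr C"
  by (simp add: hom_def)

lemma hom_DomCodI: "f \<in> Arr C \<Longrightarrow> f \<in> hom C (Dom C f) (Cod C f)"
  by (simp add: hom_def)

lemma (in category) hom_Obj: "f \<in> hom C x y \<Longrightarrow> x \<in> Obj C \<and> y \<in> Obj C"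
  using Dom_in_Obj Cod_in_Obj by (auto simp: hom_def)

lemma category_op_cat:
  assumes "category C" shows "category (op_cat C)"
proof -
  interpret category C by fact
  show ?thesis
    by unfold_locales
      (auto simp: Dom_in_Obj Cod_in_Obj Ide_in_hom Comp_Ide_left Comp_Ide_right Comp_assoc
        intro: Comp_in_hom)
qed

lemma is_functor_op:
  assumes "is_functor C D F" shows "is_functor (op_cat C) (op_cat D) F"
proof -
  interpret is_functor C D F by fact
  show ?thesis
    by (intro is_functor.intro is_functor_axioms.intro category_op_cat
        C.category_axioms D.category_axioms)
      (auto simp: ob_in_Obj ar_Ide ar_Comp intro: ar_in_hom)
qed

lemma is_functor_comp:
  assumes "is_functor C D F" and "is_functor D K G" shows "is_functor C K (G \<odot> F)"
proof -
  interpret F: is_functor C D F by fact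
  interpret G: is_functor D K G by fact
  show ?thesis
    by (intro is_functor.intro is_functor_axioms.intro F.C.category_axioms G.D.category_axioms)
      (auto simp: F.ob_in_Obj G.ob_in_Obj F.ar_Ide G.ar_Ide F.ar_Comp G.ar_Comp[OF F.ar_in_hom F.ar_in_hom]
        intro: F.ar_in_hom G.ar_in_hom)
qed

lemma is_functor_id: "category C \<Longrightarrow> is_functor C C id_fctr"
  by (intro is_functor.intro is_functor_axioms.intro) auto

lemma is_isoI:
  assumes "f \<in> hom C x y" "g \<in> hom C y x" "g \<cdot>\<^bsub>C\<^esub> f = Ide C x" "f \<cdot>\<^bsub>C\<^esub> g = Ide C y"
  shows "is_iso C f"
  using assms unfolding is_iso_def hom_def by auto

lemma is_isoE:
  assumes "is_iso C f" "f \<in> hom C x y"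
  obtains g where "g \<in> hom C y x" "g \<cdot>\<^bsub>C\<^esub> f = Ide C x" "f \<cdot>\<^bsub>C\<^esub> g = Ide C y"
  using assms unfolding is_iso_def hom_def by auto

lemma is_iso_op_cat [simp]: "is_iso (op_cat C) f = is_iso C f"
  by (auto simp: is_iso_def)

context category
begin

lemma is_iso_Ide: "x \<in> Obj C \<Longrightarrow> is_iso C (Ide C x)"
  by (rule is_isoI[OF Ide_in_hom Ide_in_hom]) (auto intro: Comp_Ide_left Ide_in_hom)

lemma iso_cancel_left:
  assumes m: "is_iso C m" "m \<in> hom C y z" and f: "f \<in> hom C x y" "g \<in> hom C x y"
    and eq: "m \<cdot> f = m \<cdot> g"
  shows "f = g"
proof -
  obtain n where n: "n \<in> hom C z y" "n \<cdot> m = Ide C y" by (rule is_isoE[OF m])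
  have "h = n \<cdot> (m \<cdot> h)" if "h \<in> hom C x y" for h
    using Comp_assoc[OF that m(2) n(1)] Comp_Ide_left[OF that] n(2) by simp
  then show ?thesis using f eq by metis
qed

lemma iso_cancel_right:
  assumes m: "is_iso C m" "m \<in> hom C x y" and f: "f \<in> hom C y z" "g \<in> hom C y z"
    and eq: "f \<cdot> m = g \<cdot> m"
  shows "f = g"
proof -
  obtain n where n: "n \<in> hom C y x" "m \<cdot> n = Ide C y" by (rule is_isoE[OF m])
  have "h = (h \<cdot> m) \<cdot> n" if "h \<in> hom C y z" for h
    using Comp_assoc[OF n(1) m(2) that] Comp_Ide_right[OF that] n(2) by simp
  then show ?thesis using f eq by metis
qed

lemma is_iso_Comp:
  assumes f: "is_iso C f" "f \<in> hom C x y" and g: "is_iso C g" "g \<in> hom C y z"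
  shows "is_iso C (g \<cdot> f)"
proof -
  obtain f' where f': "f' \<in> hom C y x" "f' \<cdot> f = Ide C x" "f \<cdot> f' = Ide C y"
    by (rule is_isoE[OF f])
  obtain g' where g': "g' \<in> hom C z y" "g' \<cdot> g = Ide C y" "g \<cdot> g' = Ide C z"
    by (rule is_isoE[OF g])
  have "(f' \<cdot> g') \<cdot> (g \<cdot> f) = f' \<cdot> ((g' \<cdot> g) \<cdot> f)"
    using Comp_assoc[OF Comp_in_hom[OF f(2) g(2)] g'(1) f'(1)] Comp_assoc[OF f(2) g(2) g'(1)]
    by simp
  moreover have "(g \<cdot> f) \<cdot> (f' \<cdot> g') = g \<cdot> ((f \<cdot> f') \<cdot> g')"
    using Comp_assoc[OF Comp_in_hom[OF g'(1) f'(1)] f(2) g(2)] Comp_assoc[OF g'(1) f'(1) f(2)]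
    by simp
  ultimately show ?thesis
    using is_isoI[OF Comp_in_hom[OF f(2) g(2)] Comp_in_hom[OF g'(1) f'(1)]]
      f' g' Comp_Ide_left[OF f(2)] Comp_Ide_left[OF g'(1)] by simp
qed

end

lemma (in is_functor) preserves_iso:
  assumes f: "is_iso C f" "f \<in> hom C x y"
  shows "is_iso D (ar F f)"
proof -
  obtain g where g: "g \<in> hom C y x" "g \<cdot>\<^bsub>C\<^esub> f = Ide C x" "f \<cdot>\<^bsub>C\<^esub> g = Ide C y"
    by (rule is_isoE[OF f])
  have "x \<in> Obj C" "y \<in> Obj C" using C.hom_Obj[OF f(2)] by auto
  then show ?thesis
    using is_isoI[OF ar_in_hom[OF f(2)] ar_in_hom[OF g(1)]]
      ar_Comp[OF f(2) g(1)] ar_Comp[OF g(1) f(2)] g ar_Ide by simp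
qed

section \<open>A dual equivalence over a reflective subcategory\<close>

locale duality_along_reflection =
  A: category A + X: category X + Y: category Y +
  reflection: adjunction Y X E inclusion_fctr \<iota> \<kappa> + duality: dual_equivalence A X T S \<eta> \<epsilon>
  for A :: "('a, 'm) cat" and X Y :: "('x, 'n) cat"
    and E :: "('x, 'n, 'x, 'n) fctr" and \<iota> :: "'x \<Rightarrow> 'n" and \<kappa> :: "'x \<Rightarrow> 'n"
    and T :: "('a, 'm, 'x, 'n) fctr" and S :: "('x, 'n, 'a, 'm) fctr"
    and \<eta> :: "'x \<Rightarrow> 'n" and \<epsilon> :: "'a \<Rightarrow> 'm" +
  assumes full: "full_subcategory X Y"
begin

lemma X_Obj: "x \<in> Obj X \<Longrightarrow> x \<in> Obj Y"
  and X_hom: "f \<in> hom X x y \<Longrightarrow> f \<in> hom Y x y"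
  and X_Ide: "x \<in> Obj X \<Longrightarrow> Ide X x = Ide Y x"
  and X_Comp: "f \<in> hom X x y \<Longrightarrow> g \<in> hom X y z \<Longrightarrow> g \<cdot>\<^bsub>X\<^esub> f = g \<cdot>\<^bsub>Y\<^esub> f"
  using full unfolding full_subcategory_def hom_def by auto

lemma X_full: "f \<in> hom Y x y \<Longrightarrow> x \<in> Obj X \<Longrightarrow> y \<in> Obj X \<Longrightarrow> f \<in> hom X x y"
  using full unfolding full_subcategory_def hom_def by auto

lemma T_Obj: "a \<in> Obj A \<Longrightarrow> ob T a \<in> Obj X"
  and T_hom: "\<phi> \<in> hom A a a' \<Longrightarrow> ar T \<phi> \<in> hom X (ob T a') (ob T a)"
  and T_Ide: "a \<in> Obj A \<Longrightarrow> ar T (Ide A a) = Ide X (ob T a)"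
  and T_Comp: "\<phi> \<in> hom A a a' \<Longrightarrow> \<psi> \<in> hom A a' a'' \<Longrightarrow>
    ar T (\<psi> \<cdot>\<^bsub>A\<^esub> \<phi>) = ar T \<phi> \<cdot>\<^bsub>X\<^esub> ar T \<psi>"
  using duality.T.ob_in_Obj duality.T.ar_in_hom duality.T.ar_Ide duality.T.ar_Comp by auto

lemma S_Obj: "x \<in> Obj X \<Longrightarrow> ob S x \<in> Obj A"
  and S_hom: "f \<in> hom X x y \<Longrightarrow> ar S f \<in> hom A (ob S y) (ob S x)"
  and S_Ide: "x \<in> Obj X \<Longrightarrow> ar S (Ide X x) = Ide A (ob S x)"
  and S_Comp: "f \<in> hom X x y \<Longrightarrow> g \<in> hom X y z \<Longrightarrow>
    ar S (g \<cdot>\<^bsub>X\<^esub> f) = ar S f \<cdot>\<^bsub>A\<^esub> ar S g"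
  using duality.S.ob_in_Obj duality.S.ar_in_hom duality.S.ar_Ide duality.S.ar_Comp by auto

lemma \<eta>_hom: "x \<in> Obj X \<Longrightarrow> \<eta> x \<in> hom X x (ob T (ob S x))"
  and \<eta>_iso: "x \<in> Obj X \<Longrightarrow> is_iso X (\<eta> x)"
  and \<eta>_nat: "f \<in> hom X x y \<Longrightarrow> ar T (ar S f) \<cdot>\<^bsub>X\<^esub> \<eta> x = \<eta> y \<cdot>\<^bsub>X\<^esub> f"
  using duality.eta.component_in_hom duality.eta.component_is_iso duality.eta.naturality by auto

lemma \<epsilon>_hom: "a \<in> Obj A \<Longrightarrow> \<epsilon> a \<in> hom A a (ob S (ob T a))"
  and \<epsilon>_iso: "a \<in> Obj A \<Longrightarrow> is_iso A (\<epsilon> a)"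
  and \<epsilon>_nat: "\<phi> \<in> hom A a a' \<Longrightarrow> ar S (ar T \<phi>) \<cdot>\<^bsub>A\<^esub> \<epsilon> a = \<epsilon> a' \<cdot>\<^bsub>A\<^esub> \<phi>"
  using duality.eps.component_in_hom duality.eps.component_is_iso duality.eps.naturality by auto

lemma E_Obj: "y \<in> Obj Y \<Longrightarrow> ob E y \<in> Obj X"
  and E_hom: "f \<in> hom Y y z \<Longrightarrow> ar E f \<in> hom X (ob E y) (ob E z)"
  by (auto intro: reflection.L.ob_in_Obj reflection.L.ar_in_hom)

lemma \<iota>_hom: "y \<in> Obj Y \<Longrightarrow> \<iota> y \<in> hom Y y (ob E y)"
  and \<iota>_nat: "f \<in> hom Y y z \<Longrightarrow> ar E f \<cdot>\<^bsub>Y\<^esub> \<iota> y = \<iota> z \<cdot>\<^bsub>Y\<^esub> f"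
  using reflection.unit.component_in_hom reflection.unit.naturality by auto

lemma \<kappa>_hom: "x \<in> Obj X \<Longrightarrow> \<kappa> x \<in> hom X (ob E x) x"
  and \<kappa>_nat: "f \<in> hom X x z \<Longrightarrow> f \<cdot>\<^bsub>X\<^esub> \<kappa> x = \<kappa> z \<cdot>\<^bsub>X\<^esub> ar E f"
  using reflection.counit.component_in_hom reflection.counit.naturality by auto

text \<open>If \<open>T \<phi> = T \<psi>\<close> then \<open>S T \<phi> = S T \<psi>\<close>, and conjugating with the natural isomorphism \<open>\<epsilon>\<close>
  recovers \<open>\<phi> = \<psi>\<close>. Faithfulness of \<open>S\<close> follows in the same way from \<open>\<eta>\<close>.\<close>

lemma T_faithful:
  assumes \<phi>: "\<phi> \<in> hom A a a'" and \<psi>: "\<psi> \<in> hom A a a'" and eq: "ar T \<phi> = ar T \<psi>"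
  shows "\<phi> = \<psi>"
  using A.iso_cancel_left[OF \<epsilon>_iso \<epsilon>_hom \<phi> \<psi>] A.hom_Obj[OF \<phi>] \<epsilon>_nat[OF \<phi>] \<epsilon>_nat[OF \<psi>] eq
  by simp

lemma S_faithful:
  assumes f: "f \<in> hom X x y" and g: "g \<in> hom X x y" and eq: "ar S f = ar S g"
  shows "f = g"
  using X.iso_cancel_left[OF \<eta>_iso \<eta>_hom f g] X.hom_Obj[OF f] \<eta>_nat[OF f] \<eta>_nat[OF g] eq
  by simp

section \<open>Extension along the unit of the reflection\<close>

text \<open>This is the transpose of \<open>j\<close> under the reflection adjunction; \<open>ext_unit\<close> and
  \<open>ext_Comp_unit\<close> show that it is inverse to precomposition with \<open>\<iota>\<close>. The explicit formula, in
  place of a choice of \<open>\<alpha>\<close> with \<open>\<alpha> \<circ> \<iota> = j\<close>, makes it available for every \<open>j\<close> with codomain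
  in \<open>X\<close>.\<close>

definition ext :: "'n \<Rightarrow> 'n" where
  "ext j = \<kappa> (Cod Y j) \<cdot>\<^bsub>X\<^esub> ar E j"

lemma ext_hom:
  assumes "j \<in> hom Y y x" "x \<in> Obj X" shows "ext j \<in> hom X (ob E y) x"
  unfolding ext_def using hom_DomCod[OF assms(1)] X.Comp_in_hom[OF E_hom[OF assms(1)] \<kappa>_hom[OF assms(2)]]
  by simp

lemma ext_unit:
  assumes j: "j \<in> hom Y y x" and x: "x \<in> Obj X" shows "ext j \<cdot>\<^bsub>Y\<^esub> \<iota> y = j"
proof -
  have y: "y \<in> Obj Y" and x': "x \<in> Obj Y" using Y.hom_Obj[OF j] by auto
  have "ext j \<cdot>\<^bsub>Y\<^esub> \<iota> y = (\<kappa> x \<cdot>\<^bsub>Y\<^esub> ar E j) \<cdot>\<^bsub>Y\<^esub> \<iota> y"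
    unfolding ext_def using hom_DomCod[OF j] X_Comp[OF E_hom[OF j] \<kappa>_hom[OF x]] by simp
  also have "\<dots> = \<kappa> x \<cdot>\<^bsub>Y\<^esub> (\<iota> x \<cdot>\<^bsub>Y\<^esub> j)"
    using Y.Comp_assoc[OF \<iota>_hom[OF y] X_hom[OF E_hom[OF j]] X_hom[OF \<kappa>_hom[OF x]]] \<iota>_nat[OF j]
    by simp
  also have "\<dots> = (\<kappa> x \<cdot>\<^bsub>Y\<^esub> \<iota> x) \<cdot>\<^bsub>Y\<^esub> j"
    using Y.Comp_assoc[OF j \<iota>_hom[OF x'] X_hom[OF \<kappa>_hom[OF x]]] by simp
  also have "\<dots> = j"
    using reflection.triangle_right[OF x] Y.Comp_Ide_left[OF j] by simp
  finally show ?thesis .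
qed

lemma ext_Comp_unit:
  assumes g: "g \<in> hom X (ob E y) x" and y: "y \<in> Obj Y"
  shows "ext (g \<cdot>\<^bsub>Y\<^esub> \<iota> y) = g"
proof -
  have "g \<cdot>\<^bsub>Y\<^esub> \<iota> y \<in> hom Y y x" by (rule Y.Comp_in_hom[OF \<iota>_hom[OF y] X_hom[OF g]])
  then have "ext (g \<cdot>\<^bsub>Y\<^esub> \<iota> y) = \<kappa> x \<cdot>\<^bsub>X\<^esub> (ar E g \<cdot>\<^bsub>X\<^esub> ar E (\<iota> y))"
    unfolding ext_def using hom_DomCod reflection.L.ar_Comp[OF \<iota>_hom[OF y] X_hom[OF g]] by fastforce
  also have "\<dots> = (g \<cdot>\<^bsub>X\<^esub> \<kappa> (ob E y)) \<cdot>\<^bsub>X\<^esub> ar E (\<iota> y)"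
    using X.Comp_assoc[OF E_hom[OF \<iota>_hom[OF y]] E_hom[OF X_hom[OF g]] \<kappa>_hom] \<kappa>_nat[OF g]
      X.hom_Obj[OF g] by simp
  also have "\<dots> = g"
    using X.Comp_assoc[OF E_hom[OF \<iota>_hom[OF y]] \<kappa>_hom[OF E_Obj[OF y]] g]
      reflection.triangle_left[OF y] X.Comp_Ide_right[OF g] by simp
  finally show ?thesis .
qed

lemma unit_cancel:
  assumes "g \<in> hom X (ob E y) x" "h \<in> hom X (ob E y) x" "y \<in> Obj Y"
    and "g \<cdot>\<^bsub>Y\<^esub> \<iota> y = h \<cdot>\<^bsub>Y\<^esub> \<iota> y"
  shows "g = h"
  using assms ext_Comp_unit by metis

abbreviation \<J> :: "'n set" where "\<J> \<equiv> J_iota X Y E \<iota>"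

lemma \<J>_I:
  assumes "\<alpha> \<in> hom X (ob E y) x" "is_iso X \<alpha>" "y \<in> Obj Y"
  shows "\<alpha> \<cdot>\<^bsub>Y\<^esub> \<iota> y \<in> \<J>"
  using assms X.hom_Obj[OF assms(1)] unfolding J_iota_def by blast

text \<open>The isomorphism in a presentation of \<open>j\<close> as an element of \<open>\<J>\<close> can only be \<open>ext j\<close>.\<close>

lemma \<J>_ext_iso:
  assumes "j \<in> \<J>"
  shows "j \<in> hom Y (Dom Y j) (Cod Y j) \<and> is_iso X (ext j)"
proof -
  obtain \<alpha> x y where j: "j = \<alpha> \<cdot>\<^bsub>Y\<^esub> \<iota> y" and y: "y \<in> Obj Y"
    and \<alpha>: "\<alpha> \<in> hom X (ob E y) x" "is_iso X \<alpha>"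
    using assms unfolding J_iota_def by blast
  have "j \<in> hom Y y x" unfolding j by (rule Y.Comp_in_hom[OF \<iota>_hom[OF y] X_hom[OF \<alpha>(1)]])
  then show ?thesis using ext_Comp_unit[OF \<alpha>(1) y] \<alpha>(2) j hom_DomCod hom_DomCodI by metis
qed

text \<open>At an object \<open>x\<close> of \<open>X\<close> the unit is invertible with inverse the counit: \<open>\<kappa>\<^sub>x \<circ> \<iota>\<^sub>x = 1\<close> is a
  triangle identity, and \<open>\<iota>\<^sub>x \<circ> \<kappa>\<^sub>x\<close>, an arrow of \<open>X\<close> because \<open>X\<close> is full, agrees with \<open>1\<close> after
  composition with \<open>\<iota>\<^sub>x\<close>. Thus \<open>1 = \<kappa>\<^sub>x \<circ> \<iota>\<^sub>x\<close> has the form required by \<open>\<J>\<close>. This is what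
  places the objects \<open>(a, 1\<^bsub>T a\<^esub>)\<close> in \<open>B\<close>.\<close>

lemma Ide_in_\<J>:
  assumes x: "x \<in> Obj X" shows "Ide X x \<in> \<J>"
proof -
  note x' = X_Obj[OF x]
  note i = X_full[OF \<iota>_hom[OF x'] x E_Obj[OF x']]
  note k = \<kappa>_hom[OF x]
  have ki: "\<kappa> x \<cdot>\<^bsub>Y\<^esub> \<iota> x = Ide Y x" using reflection.triangle_right[OF x] by simp
  have "(\<iota> x \<cdot>\<^bsub>X\<^esub> \<kappa> x) \<cdot>\<^bsub>Y\<^esub> \<iota> x = \<iota> x \<cdot>\<^bsub>Y\<^esub> (\<kappa> x \<cdot>\<^bsub>Y\<^esub> \<iota> x)"
    using X_Comp[OF k i] Y.Comp_assoc[OF \<iota>_hom[OF x'] X_hom[OF k] X_hom[OF i]] by simp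
  also have "\<dots> = Ide X (ob E x) \<cdot>\<^bsub>Y\<^esub> \<iota> x"
    using ki Y.Comp_Ide_right[OF \<iota>_hom[OF x']] Y.Comp_Ide_left[OF \<iota>_hom[OF x']]
      X_Ide[OF E_Obj[OF x']] by simp
  finally have "\<iota> x \<cdot>\<^bsub>X\<^esub> \<kappa> x = Ide X (ob E x)"
    using unit_cancel[OF X.Comp_in_hom[OF k i] X.Ide_in_hom[OF E_Obj[OF x']] x'] by simp
  moreover have "\<kappa> x \<cdot>\<^bsub>X\<^esub> \<iota> x = Ide X x" using X_Comp[OF i k] ki X_Ide[OF x] by simp
  ultimately have "is_iso X (\<kappa> x)" using is_isoI[OF k i] by simp
  then show ?thesis using \<J>_I[OF k _ x'] ki X_Ide[OF x] by simp
qed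

section \<open>The category of objects equipped with a reflection\<close>

abbreviation B :: "('a \<times> 'n, ('a \<times> 'n) \<times> ('m \<times> 'n) \<times> ('a \<times> 'n)) cat" where
  "B \<equiv> D_cat A Y T \<J>"

lemma B_Obj: "b \<in> Obj B \<longleftrightarrow> fst b \<in> Obj A \<and> snd b \<in> \<J> \<and> Cod Y (snd b) = ob T (fst b)"
  by (cases b) (simp add: D_cat_def Let_def)

lemma B_Obj_hom: "b \<in> Obj B \<Longrightarrow> snd b \<in> hom Y (Dom Y (snd b)) (ob T (fst b))"
  using \<J>_ext_iso[of "snd b"] by (simp add: B_Obj)

lemma B_Dom_Obj: "b \<in> Obj B \<Longrightarrow> Dom Y (snd b) \<in> Obj Y"
  using Y.hom_Obj[OF B_Obj_hom] by blast

lemma B_hom: "h \<in> hom B b b' \<longleftrightarrow> (\<exists>\<phi> f. h = (b, (\<phi>, f), b') \<and> b \<in> Obj B \<and> b' \<in> Obj B \<and>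
    \<phi> \<in> hom A (fst b) (fst b') \<and> f \<in> hom Y (Dom Y (snd b')) (Dom Y (snd b)) \<and>
    ar T \<phi> \<cdot>\<^bsub>Y\<^esub> snd b' = snd b \<cdot>\<^bsub>Y\<^esub> f)"
  unfolding hom_def[of B] by (cases b; cases b') (auto simp: D_cat_def Let_def)

lemma B_homI:
  assumes "b \<in> Obj B" "b' \<in> Obj B" "\<phi> \<in> hom A (fst b) (fst b')"
    "f \<in> hom Y (Dom Y (snd b')) (Dom Y (snd b))" "ar T \<phi> \<cdot>\<^bsub>Y\<^esub> snd b' = snd b \<cdot>\<^bsub>Y\<^esub> f"
  shows "(b, (\<phi>, f), b') \<in> hom B b b'"
  using assms by (auto simp: B_hom)

lemma B_homE:
  assumes "h \<in> hom B b b'"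
  obtains \<phi> f where "h = (b, (\<phi>, f), b')" "b \<in> Obj B" "b' \<in> Obj B"
    "\<phi> \<in> hom A (fst b) (fst b')" "f \<in> hom Y (Dom Y (snd b')) (Dom Y (snd b))"
    "ar T \<phi> \<cdot>\<^bsub>Y\<^esub> snd b' = snd b \<cdot>\<^bsub>Y\<^esub> f"
  using assms by (auto simp: B_hom)

lemma B_Comp [simp]:
  "(b', (\<phi>', f'), b'') \<cdot>\<^bsub>B\<^esub> (b, (\<phi>, f), c) = (b, (\<phi>' \<cdot>\<^bsub>A\<^esub> \<phi>, f \<cdot>\<^bsub>Y\<^esub> f'), b'')"
  by (simp add: D_cat_def Let_def)

lemma B_Ide: "Ide B b = (b, (Ide A (fst b), Ide Y (Dom Y (snd b))), b)"
  by (cases b) (simp add: D_cat_def Let_def)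

lemma B_Arr: "h \<in> Arr B \<Longrightarrow> h \<in> hom B (fst h) (snd (snd h))"
  unfolding hom_def[of B] by (auto simp: D_cat_def Let_def)

text \<open>The laws are those of \<open>A\<close> and of the opposite of \<open>Y\<close>, read componentwise; the one thing to
  prove is that pasting two commuting squares gives a commuting square.\<close>

lemma category_B: "category B"
proof
  fix h assume "h \<in> Arr B"
  then have h: "h \<in> hom B (fst h) (snd (snd h))" by (rule B_Arr)
  have "Dom B h = fst h" "Cod B h = snd (snd h)" using hom_DomCod[OF h] by auto
  then show "Dom B h \<in> Obj B" "Cod B h \<in> Obj B" using h by (auto elim: B_homE)
next
  fix b assume b: "b \<in> Obj B"
  note j = B_Obj_hom[OF b]
  have a: "fst b \<in> Obj A" using b by (simp add: B_Obj)
  show "Ide B b \<in> hom B b b"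
    unfolding B_Ide using a Y.hom_Obj[OF j] Y.Comp_Ide_left[OF j] Y.Comp_Ide_right[OF j]
    by (intro B_homI b A.Ide_in_hom Y.Ide_in_hom) (auto simp: T_Ide X_Ide T_Obj)
next
  fix h k b b' b'' assume h: "h \<in> hom B b b'" and k: "k \<in> hom B b' b''"
  obtain \<phi> f where h: "h = (b, (\<phi>, f), b')" "b \<in> Obj B" "b' \<in> Obj B"
    "\<phi> \<in> hom A (fst b) (fst b')" "f \<in> hom Y (Dom Y (snd b')) (Dom Y (snd b))"
    "ar T \<phi> \<cdot>\<^bsub>Y\<^esub> snd b' = snd b \<cdot>\<^bsub>Y\<^esub> f" by (rule B_homE[OF h])
  obtain \<psi> g where k: "k = (b', (\<psi>, g), b'')" "b' \<in> Obj B" "b'' \<in> Obj B"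
    "\<psi> \<in> hom A (fst b') (fst b'')" "g \<in> hom Y (Dom Y (snd b'')) (Dom Y (snd b'))"
    "ar T \<psi> \<cdot>\<^bsub>Y\<^esub> snd b'' = snd b' \<cdot>\<^bsub>Y\<^esub> g" by (rule B_homE[OF k])
  note j = B_Obj_hom[OF h(2)] and j' = B_Obj_hom[OF h(3)] and j'' = B_Obj_hom[OF k(3)]
  note T\<phi> = X_hom[OF T_hom[OF h(4)]] and T\<psi> = X_hom[OF T_hom[OF k(4)]]
  have "ar T (\<psi> \<cdot>\<^bsub>A\<^esub> \<phi>) \<cdot>\<^bsub>Y\<^esub> snd b'' = ar T \<phi> \<cdot>\<^bsub>Y\<^esub> (snd b' \<cdot>\<^bsub>Y\<^esub> g)"
    using T_Comp[OF h(4) k(4)] X_Comp[OF T_hom[OF k(4)] T_hom[OF h(4)]]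
      Y.Comp_assoc[OF j'' T\<psi> T\<phi>] k(6) by simp
  also have "\<dots> = snd b \<cdot>\<^bsub>Y\<^esub> (f \<cdot>\<^bsub>Y\<^esub> g)"
    using Y.Comp_assoc[OF k(5) j' T\<phi>] h(6) Y.Comp_assoc[OF k(5) h(5) j] by simp
  finally show "k \<cdot>\<^bsub>B\<^esub> h \<in> hom B b b''"
    unfolding h(1) k(1) B_Comp
    by (intro B_homI h k A.Comp_in_hom[OF h(4) k(4)] Y.Comp_in_hom[OF k(5) h(5)])
qed (auto elim!: B_homE simp: B_Ide A.Comp_Ide_left A.Comp_Ide_right
    Y.Comp_Ide_left Y.Comp_Ide_right A.Comp_assoc Y.Comp_assoc)

sublocale B: category B by (rule category_B)

definition T' :: "('a \<times> 'n, ('a \<times> 'n) \<times> ('m \<times> 'n) \<times> ('a \<times> 'n), 'x, 'n) fctr" where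
  "T' = \<lparr>ob = (\<lambda>b. Dom Y (snd b)), ar = (\<lambda>h. snd (fst (snd h)))\<rparr>"

definition D :: "('a \<times> 'n, ('a \<times> 'n) \<times> ('m \<times> 'n) \<times> ('a \<times> 'n), 'a, 'm) fctr" where
  "D = \<lparr>ob = fst, ar = (\<lambda>h. fst (fst (snd h)))\<rparr>"

lemma T'_simps [simp]: "ob T' b = Dom Y (snd b)" "ar T' (b, (\<phi>, f), b') = f"
  and D_simps [simp]: "ob D b = fst b" "ar D (b, (\<phi>, f), b') = \<phi>"
  by (simp_all add: T'_def D_def)

lemma functor_T': "is_functor B (op_cat Y) T'"
  by (intro is_functor.intro is_functor_axioms.intro category_op_cat category_B Y.category_axioms)
    (auto elim!: B_homE simp: B_Ide B_Dom_Obj)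

lemma functor_D: "is_functor B A D"
  by (intro is_functor.intro is_functor_axioms.intro category_B A.category_axioms)
    (auto elim!: B_homE simp: B_Ide B_Obj)

sublocale T': is_functor B "op_cat Y" T' by (rule functor_T')

lemma B_ext_hom: "b \<in> Obj B \<Longrightarrow> ext (snd b) \<in> hom X (ob E (Dom Y (snd b))) (ob T (fst b))"
  using ext_hom[OF B_Obj_hom] by (simp add: B_Obj T_Obj)

lemma B_ext_unit: "b \<in> Obj B \<Longrightarrow> ext (snd b) \<cdot>\<^bsub>Y\<^esub> \<iota> (Dom Y (snd b)) = snd b"
  using ext_unit[OF B_Obj_hom] by (simp add: B_Obj T_Obj)

lemma B_ext_iso: "b \<in> Obj B \<Longrightarrow> is_iso X (ext (snd b))"
  using \<J>_ext_iso by (simp add: B_Obj)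

text \<open>Both sides are arrows of \<open>X\<close> out of a reflection, so they may be compared after composition
  with \<open>\<iota>\<close>, where the equation becomes the square that defines an arrow of \<open>B\<close>. This is the
  naturality of \<open>\<beta>\<close>, and it also shows that \<open>f\<close> determines \<open>T \<phi>\<close>.\<close>

lemma B_ext_square:
  assumes "(b, (\<phi>, f), b') \<in> hom B b b'"
  shows "ar T \<phi> \<cdot>\<^bsub>X\<^esub> ext (snd b') = ext (snd b) \<cdot>\<^bsub>X\<^esub> ar E f"
proof -
  have b: "b \<in> Obj B" "b' \<in> Obj B" and \<phi>: "\<phi> \<in> hom A (fst b) (fst b')"
    and f: "f \<in> hom Y (Dom Y (snd b')) (Dom Y (snd b))"
    and eq: "ar T \<phi> \<cdot>\<^bsub>Y\<^esub> snd b' = snd b \<cdot>\<^bsub>Y\<^esub> f"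
    using assms by (auto elim!: B_homE)
  note e = B_ext_hom[OF b(1)] and e' = B_ext_hom[OF b(2)]
  have y: "Dom Y (snd b) \<in> Obj Y" "Dom Y (snd b') \<in> Obj Y" using Y.hom_Obj[OF f] by auto
  have "(ar T \<phi> \<cdot>\<^bsub>X\<^esub> ext (snd b')) \<cdot>\<^bsub>Y\<^esub> \<iota> (Dom Y (snd b')) = ar T \<phi> \<cdot>\<^bsub>Y\<^esub> snd b'"
    using X_Comp[OF e' T_hom[OF \<phi>]] B_ext_unit[OF b(2)]
      Y.Comp_assoc[OF \<iota>_hom[OF y(2)] X_hom[OF e'] X_hom[OF T_hom[OF \<phi>]]] by simp
  also have "\<dots> = (ext (snd b) \<cdot>\<^bsub>Y\<^esub> \<iota> (Dom Y (snd b))) \<cdot>\<^bsub>Y\<^esub> f"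
    using eq B_ext_unit[OF b(1)] by simp
  also have "\<dots> = (ext (snd b) \<cdot>\<^bsub>X\<^esub> ar E f) \<cdot>\<^bsub>Y\<^esub> \<iota> (Dom Y (snd b'))"
    using X_Comp[OF E_hom[OF f] e] \<iota>_nat[OF f]
      Y.Comp_assoc[OF f \<iota>_hom[OF y(1)] X_hom[OF e]]
      Y.Comp_assoc[OF \<iota>_hom[OF y(2)] X_hom[OF E_hom[OF f]] X_hom[OF e]] by simp
  finally show ?thesis
    using unit_cancel[OF X.Comp_in_hom[OF e' T_hom[OF \<phi>]] X.Comp_in_hom[OF E_hom[OF f] e] y(2)]
    by simp
qed

text \<open>As \<open>ext (snd b')\<close> is invertible, the extended square determines \<open>T \<phi>\<close>, and hence \<open>\<phi>\<close>,
  from \<open>f\<close>.\<close>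

lemma T'_faithful:
  assumes h: "h \<in> hom B b b'" and k: "k \<in> hom B b b'" and eq: "ar T' h = ar T' k"
  shows "h = k"
proof -
  obtain \<phi> f where h': "h = (b, (\<phi>, f), b')" and b': "b' \<in> Obj B"
    and \<phi>: "\<phi> \<in> hom A (fst b) (fst b')" by (rule B_homE[OF h])
  obtain \<psi> g where k': "k = (b, (\<psi>, g), b')" and \<psi>: "\<psi> \<in> hom A (fst b) (fst b')"
    by (rule B_homE[OF k])
  have fg: "f = g" using eq h' k' by simp
  have "ar T \<phi> \<cdot>\<^bsub>X\<^esub> ext (snd b') = ar T \<psi> \<cdot>\<^bsub>X\<^esub> ext (snd b')"
    using B_ext_square[OF h[unfolded h']] B_ext_square[OF k[unfolded k']] fg by simp
  then have "ar T \<phi> = ar T \<psi>"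
    using X.iso_cancel_right[OF B_ext_iso[OF b'] B_ext_hom[OF b'] T_hom[OF \<phi>] T_hom[OF \<psi>]] by simp
  then show ?thesis using T_faithful[OF \<phi> \<psi>] h' k' fg by simp
qed

text \<open>A square with two invertible sides can be inverted along them.\<close>

lemma B_isoI:
  assumes h: "(b, (\<phi>, f), b') \<in> hom B b b'" and \<phi>: "is_iso A \<phi>" and f: "is_iso Y f"
  shows "is_iso B (b, (\<phi>, f), b')"
proof -
  have b: "b \<in> Obj B" "b' \<in> Obj B" and \<phi>h: "\<phi> \<in> hom A (fst b) (fst b')"
    and fh: "f \<in> hom Y (Dom Y (snd b')) (Dom Y (snd b))"
    and eq: "ar T \<phi> \<cdot>\<^bsub>Y\<^esub> snd b' = snd b \<cdot>\<^bsub>Y\<^esub> f"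
    using h by (auto elim!: B_homE)
  note j = B_Obj_hom[OF b(1)] and j' = B_Obj_hom[OF b(2)]
  obtain \<psi> where \<psi>: "\<psi> \<in> hom A (fst b') (fst b)" "\<psi> \<cdot>\<^bsub>A\<^esub> \<phi> = Ide A (fst b)"
    "\<phi> \<cdot>\<^bsub>A\<^esub> \<psi> = Ide A (fst b')" by (rule is_isoE[OF \<phi> \<phi>h])
  obtain g where g: "g \<in> hom Y (Dom Y (snd b)) (Dom Y (snd b'))"
    "g \<cdot>\<^bsub>Y\<^esub> f = Ide Y (Dom Y (snd b'))" "f \<cdot>\<^bsub>Y\<^esub> g = Ide Y (Dom Y (snd b))"
    by (rule is_isoE[OF f fh])
  note T\<phi> = X_hom[OF T_hom[OF \<phi>h]] and T\<psi> = X_hom[OF T_hom[OF \<psi>(1)]]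
  have TT: "ar T \<psi> \<cdot>\<^bsub>Y\<^esub> ar T \<phi> = Ide Y (ob T (fst b'))"
    using T_Comp[OF \<psi>(1) \<phi>h] X_Comp[OF T_hom[OF \<phi>h] T_hom[OF \<psi>(1)]] \<psi>(3) b(2)
    by (simp add: B_Obj T_Ide X_Ide T_Obj)
  have "ar T \<psi> \<cdot>\<^bsub>Y\<^esub> snd b = ar T \<psi> \<cdot>\<^bsub>Y\<^esub> ((snd b \<cdot>\<^bsub>Y\<^esub> f) \<cdot>\<^bsub>Y\<^esub> g)"
    using Y.Comp_assoc[OF g(1) fh j] g(3) Y.Comp_Ide_right[OF j] by simp
  also have "\<dots> = (ar T \<psi> \<cdot>\<^bsub>Y\<^esub> ar T \<phi>) \<cdot>\<^bsub>Y\<^esub> (snd b' \<cdot>\<^bsub>Y\<^esub> g)"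
    using eq Y.Comp_assoc[OF g(1) j' T\<phi>] Y.Comp_assoc[OF Y.Comp_in_hom[OF g(1) j'] T\<phi> T\<psi>] by simp
  also have "\<dots> = snd b' \<cdot>\<^bsub>Y\<^esub> g"
    using TT Y.Comp_Ide_left[OF Y.Comp_in_hom[OF g(1) j']] by simp
  finally have "(b', (\<psi>, g), b) \<in> hom B b' b" by (intro B_homI b \<psi> g)
  then show ?thesis using is_isoI[OF h] \<psi> g by (simp add: B_Ide)
qed

section \<open>The lifted dual equivalence\<close>

definition ob_S' :: "'x \<Rightarrow> 'a \<times> 'n" where
  "ob_S' y = (ob S (ob E y), \<eta> (ob E y) \<cdot>\<^bsub>Y\<^esub> \<iota> y)"

definition S' :: "('x, 'n, 'a \<times> 'n, ('a \<times> 'n) \<times> ('m \<times> 'n) \<times> ('a \<times> 'n)) fctr" where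
  "S' = \<lparr>ob = ob_S', ar = (\<lambda>f. (ob_S' (Cod Y f), (ar S (ar E f), f), ob_S' (Dom Y f)))\<rparr>"

definition \<epsilon>' :: "'a \<times> 'n \<Rightarrow> ('a \<times> 'n) \<times> ('m \<times> 'n) \<times> ('a \<times> 'n)" where
  "\<epsilon>' b = (b, (ar S (ext (snd b)) \<cdot>\<^bsub>A\<^esub> \<epsilon> (fst b), Ide Y (Dom Y (snd b))), ob_S' (Dom Y (snd b)))"

lemma S'_ob [simp]: "ob S' y = ob_S' y"
  and S'_ar: "f \<in> hom Y y z \<Longrightarrow> ar S' f = (ob_S' z, (ar S (ar E f), f), ob_S' y)"
  by (auto simp: S'_def hom_def)

lemma ob_S'_hom:
  assumes y: "y \<in> Obj Y" shows "snd (ob_S' y) \<in> hom Y y (ob T (ob S (ob E y)))"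
  using Y.Comp_in_hom[OF \<iota>_hom[OF y] X_hom[OF \<eta>_hom[OF E_Obj[OF y]]]] by (simp add: ob_S'_def)

lemma ob_S'_Dom [simp]: "y \<in> Obj Y \<Longrightarrow> Dom Y (snd (ob_S' y)) = y"
  using hom_DomCod[OF ob_S'_hom] by simp

lemma ob_S'_fst [simp]: "fst (ob_S' y) = ob S (ob E y)"
  by (simp add: ob_S'_def)

lemma ob_S'_ext [simp]: "y \<in> Obj Y \<Longrightarrow> ext (snd (ob_S' y)) = \<eta> (ob E y)"
  using ext_Comp_unit[OF \<eta>_hom[OF E_Obj]] by (simp add: ob_S'_def)

lemma ob_S'_Obj: "y \<in> Obj Y \<Longrightarrow> ob_S' y \<in> Obj B"
  using hom_DomCod[OF ob_S'_hom] \<J>_I[OF \<eta>_hom[OF E_Obj] \<eta>_iso[OF E_Obj]]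
  by (simp add: B_Obj S_Obj E_Obj) (simp add: ob_S'_def)

text \<open>The square is the naturality of \<open>\<iota>\<close> at \<open>f\<close> pasted to that of \<open>\<eta>\<close> at \<open>E f\<close>.\<close>

lemma S'_hom:
  assumes f: "f \<in> hom Y y z"
  shows "ar S' f \<in> hom B (ob_S' z) (ob_S' y)"
proof -
  have y: "y \<in> Obj Y" and z: "z \<in> Obj Y" using Y.hom_Obj[OF f] by auto
  note Ef = E_hom[OF f] and \<eta>y = \<eta>_hom[OF E_Obj[OF y]] and \<eta>z = \<eta>_hom[OF E_Obj[OF z]]
  note TSEf = T_hom[OF S_hom[OF Ef]]
  have "ar T (ar S (ar E f)) \<cdot>\<^bsub>Y\<^esub> snd (ob_S' y)
      = (ar T (ar S (ar E f)) \<cdot>\<^bsub>X\<^esub> \<eta> (ob E y)) \<cdot>\<^bsub>Y\<^esub> \<iota> y"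
    using Y.Comp_assoc[OF \<iota>_hom[OF y] X_hom[OF \<eta>y] X_hom[OF TSEf]] X_Comp[OF \<eta>y TSEf]
    by (simp add: ob_S'_def)
  also have "\<dots> = \<eta> (ob E z) \<cdot>\<^bsub>Y\<^esub> (\<iota> z \<cdot>\<^bsub>Y\<^esub> f)"
    using \<eta>_nat[OF Ef] X_Comp[OF Ef \<eta>z] Y.Comp_assoc[OF \<iota>_hom[OF y] X_hom[OF Ef] X_hom[OF \<eta>z]]
      \<iota>_nat[OF f] by simp
  also have "\<dots> = snd (ob_S' z) \<cdot>\<^bsub>Y\<^esub> f"
    using Y.Comp_assoc[OF f \<iota>_hom[OF z] X_hom[OF \<eta>z]] by (simp add: ob_S'_def)
  finally show ?thesis
    unfolding S'_ar[OF f] using y z f S_hom[OF Ef] by (intro B_homI ob_S'_Obj) auto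
qed

lemma functor_S': "is_functor (op_cat Y) B S'"
proof (intro is_functor.intro is_functor_axioms.intro category_op_cat category_B Y.category_axioms)
  fix y assume "y \<in> Obj (op_cat Y)"
  then have y: "y \<in> Obj Y" by simp
  show "ob S' y \<in> Obj B" using ob_S'_Obj[OF y] by simp
  show "ar S' (Ide (op_cat Y) y) = Ide B (ob S' y)"
    using S'_ar[OF Y.Ide_in_hom[OF y]] y
    by (simp add: B_Ide reflection.L.ar_Ide S_Ide E_Obj)
next
  fix f y z assume f: "f \<in> hom (op_cat Y) y z"
  then show "ar S' f \<in> hom B (ob S' y) (ob S' z)" using S'_hom by simp
  fix g w assume g: "g \<in> hom (op_cat Y) z w"
  have f': "f \<in> hom Y z y" and g': "g \<in> hom Y w z" using f g by auto
  show "ar S' (g \<cdot>\<^bsub>op_cat Y\<^esub> f) = ar S' g \<cdot>\<^bsub>B\<^esub> ar S' f"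
    using S'_ar[OF f'] S'_ar[OF g'] S'_ar[OF Y.Comp_in_hom[OF g' f']]
      reflection.L.ar_Comp[OF g' f'] S_Comp[OF E_hom[OF g'] E_hom[OF f']] by simp
qed

sublocale S': is_functor "op_cat Y" B S' by (rule functor_S')

lemma T'_S'_ar: "f \<in> hom Y y z \<Longrightarrow> ar T' (ar S' f) = f"
  by (simp add: S'_ar)

text \<open>The transpose of \<open>\<alpha> : x \<rightarrow> T a\<close> under the duality, by the triangle identity for \<open>T\<close>.
  With \<open>\<alpha> = ext j\<close> it provides the first component of \<open>\<epsilon>'\<close>.\<close>

lemma T_transpose:
  assumes x: "x \<in> Obj X" and a: "a \<in> Obj A" and \<alpha>: "\<alpha> \<in> hom X x (ob T a)"
  shows "ar T (ar S \<alpha> \<cdot>\<^bsub>A\<^esub> \<epsilon> a) \<cdot>\<^bsub>X\<^esub> \<eta> x = \<alpha>"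
proof -
  note e = \<epsilon>_hom[OF a] and n = \<eta>_hom[OF x] and n' = \<eta>_hom[OF T_Obj[OF a]]
  note S\<alpha> = S_hom[OF \<alpha>]
  have "ar T (ar S \<alpha> \<cdot>\<^bsub>A\<^esub> \<epsilon> a) \<cdot>\<^bsub>X\<^esub> \<eta> x = ar T (\<epsilon> a) \<cdot>\<^bsub>X\<^esub> (\<eta> (ob T a) \<cdot>\<^bsub>X\<^esub> \<alpha>)"
    using T_Comp[OF e S\<alpha>] X.Comp_assoc[OF n T_hom[OF S\<alpha>] T_hom[OF e]] \<eta>_nat[OF \<alpha>] by simp
  also have "\<dots> = \<alpha>"
    using X.Comp_assoc[OF \<alpha> n' T_hom[OF e]] duality.triangle_T[OF a] X.Comp_Ide_left[OF \<alpha>] by simp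
  finally show ?thesis .
qed

lemma \<epsilon>'_fst_hom:
  assumes b: "b \<in> Obj B"
  shows "ar S (ext (snd b)) \<cdot>\<^bsub>A\<^esub> \<epsilon> (fst b) \<in> hom A (fst b) (ob S (ob E (Dom Y (snd b))))"
  using A.Comp_in_hom[OF \<epsilon>_hom S_hom[OF B_ext_hom[OF b]]] b by (simp add: B_Obj)

lemma \<epsilon>'_hom:
  assumes b: "b \<in> Obj B"
  shows "\<epsilon>' b \<in> hom B b (ob_S' (Dom Y (snd b)))"
proof -
  let ?y = "Dom Y (snd b)" and ?\<phi> = "ar S (ext (snd b)) \<cdot>\<^bsub>A\<^esub> \<epsilon> (fst b)"
  have y: "?y \<in> Obj Y" and a: "fst b \<in> Obj A"
    using Y.hom_Obj[OF B_Obj_hom[OF b]] b by (auto simp: B_Obj)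
  note n = \<eta>_hom[OF E_Obj[OF y]] and \<phi> = \<epsilon>'_fst_hom[OF b]
  have "ar T ?\<phi> \<cdot>\<^bsub>Y\<^esub> snd (ob_S' ?y) = (ar T ?\<phi> \<cdot>\<^bsub>X\<^esub> \<eta> (ob E ?y)) \<cdot>\<^bsub>Y\<^esub> \<iota> ?y"
    using Y.Comp_assoc[OF \<iota>_hom[OF y] X_hom[OF n] X_hom[OF T_hom[OF \<phi>]]] X_Comp[OF n T_hom[OF \<phi>]]
    by (simp add: ob_S'_def)
  also have "\<dots> = snd b \<cdot>\<^bsub>Y\<^esub> Ide Y ?y"
    using T_transpose[OF E_Obj[OF y] a B_ext_hom[OF b]] B_ext_unit[OF b]
      Y.Comp_Ide_right[OF B_Obj_hom[OF b]] by simp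
  finally show ?thesis
    unfolding \<epsilon>'_def using y b \<phi> Y.Ide_in_hom[OF y] by (intro B_homI ob_S'_Obj) auto
qed

lemma \<epsilon>'_iso:
  assumes b: "b \<in> Obj B"
  shows "is_iso B (\<epsilon>' b)"
proof -
  have y: "Dom Y (snd b) \<in> Obj Y" and a: "fst b \<in> Obj A"
    using Y.hom_Obj[OF B_Obj_hom[OF b]] b by (auto simp: B_Obj)
  have "is_iso A (ar S (ext (snd b)))"
    using duality.S.preserves_iso[of "ext (snd b)"] B_ext_iso[OF b] B_ext_hom[OF b] by simp
  then have "is_iso A (ar S (ext (snd b)) \<cdot>\<^bsub>A\<^esub> \<epsilon> (fst b))"
    using A.is_iso_Comp[OF \<epsilon>_iso[OF a] \<epsilon>_hom[OF a] _ S_hom[OF B_ext_hom[OF b]]] by simp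
  then show ?thesis
    using B_isoI[OF \<epsilon>'_hom[OF b, unfolded \<epsilon>'_def]] Y.is_iso_Ide[OF y] by (simp add: \<epsilon>'_def)
qed

lemma T'_\<epsilon>' [simp]: "ar T' (\<epsilon>' b) = Ide Y (Dom Y (snd b))"
  by (simp add: \<epsilon>'_def)

lemma \<epsilon>'_S':
  assumes y: "y \<in> Obj Y" shows "\<epsilon>' (ob_S' y) = Ide B (ob_S' y)"
  by (rule T'_faithful[where b = "ob_S' y" and b' = "ob_S' y"])
    (use \<epsilon>'_hom[OF ob_S'_Obj[OF y]] B.Ide_in_hom[OF ob_S'_Obj[OF y]] y in \<open>simp_all add: B_Ide\<close>)

text \<open>Every component of \<open>\<epsilon>'\<close> lies over an identity of \<open>Y\<close>, so its naturality follows from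
  \<open>T' \<circ> S' = 1\<close> by faithfulness of \<open>T'\<close>. In each triangle identity both factors are identities.\<close>

lemma dual_equivalence_lift: "dual_equivalence B Y T' S' (\<lambda>y. Ide Y y) \<epsilon>'"
proof -
  note TS = is_functor_comp[OF is_functor_op[OF functor_S'] is_functor_op[OF functor_T'], simplified]
  note ST = is_functor_comp[OF functor_T' functor_S']
  have unit: "nat_iso Y Y id_fctr (T' \<odot> S') (\<lambda>y. Ide Y y)"
    by (intro nat_iso.intro nat_trans.intro nat_trans_axioms.intro nat_iso_axioms.intro
        is_functor_id Y.category_axioms TS)
      (auto simp: Y.Ide_in_hom T'_S'_ar Y.Comp_Ide_left Y.Comp_Ide_right Y.is_iso_Ide
        dest: Y.hom_Obj)
  have nat: "ar (S' \<odot> T') h \<cdot>\<^bsub>B\<^esub> \<epsilon>' b = \<epsilon>' b' \<cdot>\<^bsub>B\<^esub> ar id_fctr h" if h: "h \<in> hom B b b'" for h b b'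
  proof -
    obtain \<phi> f where h': "h = (b, (\<phi>, f), b')" and b: "b \<in> Obj B" "b' \<in> Obj B"
      and f: "f \<in> hom Y (Dom Y (snd b')) (Dom Y (snd b))" by (rule B_homE[OF h])
    note e = \<epsilon>'_hom[OF b(1)] and e' = \<epsilon>'_hom[OF b(2)] and S'f = S'_hom[OF f]
    have "ar S' f \<cdot>\<^bsub>B\<^esub> \<epsilon>' b = \<epsilon>' b' \<cdot>\<^bsub>B\<^esub> h"
      by (rule T'_faithful[OF B.Comp_in_hom[OF e S'f] B.Comp_in_hom[OF h e']])
        (simp add: T'.ar_Comp[OF e S'f] T'.ar_Comp[OF h e'] T'_S'_ar[OF f]
          Y.Comp_Ide_left[OF f] Y.Comp_Ide_right[OF f], simp add: h' Y.Comp_Ide_left[OF f] Y.Comp_Ide_right[OF f])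
    then show ?thesis by (simp add: h')
  qed
  have counit: "nat_iso B B id_fctr (S' \<odot> T') \<epsilon>'"
    by (intro nat_iso.intro nat_trans.intro nat_trans_axioms.intro nat_iso_axioms.intro
        is_functor_id category_B ST) (use \<epsilon>'_hom \<epsilon>'_iso nat in auto)
  show ?thesis
    by (intro dual_equivalence.intro dual_equivalence_axioms.intro functor_T' functor_S' unit counit)
      (auto dest!: B_Obj_hom Y.hom_Obj simp: \<epsilon>'_S' S'.ar_Ide[simplified] ob_S'_Obj
        intro!: Y.Comp_Ide_left[OF Y.Ide_in_hom] B.Comp_Ide_left[OF B.Ide_in_hom])
qed

section \<open>The embedding and its coreflector\<close>

abbreviation I :: "('a, 'm, 'a \<times> 'n, ('a \<times> 'n) \<times> ('m \<times> 'n) \<times> ('a \<times> 'n)) fctr" where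
  "I \<equiv> I_fctr A X T"

lemma I_ob: "ob I a = (a, Ide X (ob T a))"
  and I_ar: "\<phi> \<in> hom A a a' \<Longrightarrow> ar I \<phi> = (ob I a, (\<phi>, ar T \<phi>), ob I a')"
  by (auto simp: I_fctr_def hom_def)

lemma I_fst [simp]: "fst (ob I a) = a"
  by (simp add: I_ob)

lemma snd_I: "a \<in> Obj A \<Longrightarrow> snd (ob I a) = Ide Y (ob T a)"
  by (simp add: I_ob X_Ide T_Obj)

lemma I_snd_hom: "a \<in> Obj A \<Longrightarrow> snd (ob I a) \<in> hom Y (ob T a) (ob T a)"
  using X_hom[OF X.Ide_in_hom[OF T_Obj]] by (simp add: I_ob)

lemma I_Dom [simp]: "a \<in> Obj A \<Longrightarrow> Dom Y (snd (ob I a)) = ob T a"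
  using hom_DomCod[OF I_snd_hom] by simp

lemma I_Obj: "a \<in> Obj A \<Longrightarrow> ob I a \<in> Obj B"
  using hom_DomCod[OF I_snd_hom] by (simp add: B_Obj) (simp add: I_ob Ide_in_\<J> T_Obj)

text \<open>Between objects \<open>(a, 1)\<close> and \<open>(a', 1)\<close> the square of \<open>(\<phi>, f)\<close> says that \<open>f = T \<phi>\<close>;
  hence \<open>I\<close> is full.\<close>

lemma I_hom_iff:
  assumes a: "a \<in> Obj A" "a' \<in> Obj A"
  shows "h \<in> hom B (ob I a) (ob I a') \<longleftrightarrow> (\<exists>\<phi> \<in> hom A a a'. h = ar I \<phi>)"
proof -
  have sq: "ar T \<phi> \<cdot>\<^bsub>Y\<^esub> snd (ob I a') = snd (ob I a) \<cdot>\<^bsub>Y\<^esub> f \<longleftrightarrow> ar T \<phi> = f"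
    if "\<phi> \<in> hom A a a'" "f \<in> hom Y (ob T a') (ob T a)" for \<phi> f
    using Y.Comp_Ide_left[OF that(2)] Y.Comp_Ide_right[OF X_hom[OF T_hom[OF that(1)]]]
      X_Ide[OF T_Obj] a by (simp add: I_ob)
  show ?thesis
    unfolding B_hom using a I_Obj sq by (auto simp: I_ar X_hom T_hom)
qed

lemma functor_I: "is_functor A B I"
proof (intro is_functor.intro is_functor_axioms.intro category_B A.category_axioms I_Obj)
  fix \<phi> a a' assume \<phi>: "\<phi> \<in> hom A a a'"
  then show "ar I \<phi> \<in> hom B (ob I a) (ob I a')" using I_hom_iff A.hom_Obj[OF \<phi>] by blast
  fix \<psi> a'' assume \<psi>: "\<psi> \<in> hom A a' a''"
  show "ar I (\<psi> \<cdot>\<^bsub>A\<^esub> \<phi>) = ar I \<psi> \<cdot>\<^bsub>B\<^esub> ar I \<phi>"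
    using I_ar[OF \<phi>] I_ar[OF \<psi>] I_ar[OF A.Comp_in_hom[OF \<phi> \<psi>]] T_Comp[OF \<phi> \<psi>]
      X_Comp[OF T_hom[OF \<psi>] T_hom[OF \<phi>]] by simp
next
  fix a assume a: "a \<in> Obj A"
  show "ar I (Ide A a) = Ide B (ob I a)"
    using I_ar[OF A.Ide_in_hom[OF a]] a by (simp add: B_Ide T_Ide X_Ide T_Obj)
qed

sublocale I: is_functor A B I by (rule functor_I)

lemma full_embedding_I: "full_embedding A B I"
proof -
  have "inj_on (ob I) (Obj A)" by (auto simp: inj_on_def I_ob)
  moreover have "bij_betw (ar I) (hom A a a') (hom B (ob I a) (ob I a'))"
    if "a \<in> Obj A" "a' \<in> Obj A" for a a'
  proof -
    have "inj_on (ar I) (hom A a a')" by (auto simp: inj_on_def I_ar)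
    moreover have "ar I ` hom A a a' = hom B (ob I a) (ob I a')"
      using I_hom_iff[OF that] by blast
    ultimately show ?thesis by (simp add: bij_betw_def)
  qed
  ultimately show ?thesis unfolding full_embedding_def using functor_I by blast
qed

definition \<rho> :: "'a \<times> 'n \<Rightarrow> ('a \<times> 'n) \<times> ('m \<times> 'n) \<times> ('a \<times> 'n)" where
  "\<rho> b = (ob I (fst b), (Ide A (fst b), snd b), b)"

lemma T'_\<rho> [simp]: "ar T' (\<rho> b) = snd b"
  by (simp add: \<rho>_def)

lemma \<rho>_hom:
  assumes b: "b \<in> Obj B" shows "\<rho> b \<in> hom B (ob I (fst b)) b"
  unfolding \<rho>_def
  using b B_Obj_hom[OF b] Y.Comp_Ide_left[OF B_Obj_hom[OF b]]
  by (intro B_homI I_Obj) (auto simp: B_Obj A.Ide_in_hom T_Ide X_Ide T_Obj, simp add: snd_I)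

lemma \<rho>_I: "a \<in> Obj A \<Longrightarrow> \<rho> (ob I a) = Ide B (ob I a)"
  by (simp add: \<rho>_def B_Ide) (simp add: I_ob X_Ide T_Obj)

text \<open>The square that defines an arrow of \<open>B\<close> is also the naturality square of \<open>\<rho>\<close>.\<close>

lemma coreflection: "adjunction A B I D (\<lambda>a. Ide A a) \<rho>"
proof -
  note DI = is_functor_comp[OF functor_I functor_D] and ID = is_functor_comp[OF functor_D functor_I]
  have unit: "nat_trans A A id_fctr (D \<odot> I) (\<lambda>a. Ide A a)"
    by (intro nat_trans.intro nat_trans_axioms.intro is_functor_id A.category_axioms DI)
      (auto simp: A.Ide_in_hom I_ar A.Comp_Ide_left A.Comp_Ide_right)
  have nat: "ar id_fctr h \<cdot>\<^bsub>B\<^esub> \<rho> b = \<rho> b' \<cdot>\<^bsub>B\<^esub> ar (I \<odot> D) h" if h: "h \<in> hom B b b'" for h b b'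
  proof -
    obtain \<phi> f where h': "h = (b, (\<phi>, f), b')" and \<phi>: "\<phi> \<in> hom A (fst b) (fst b')"
      and sq: "ar T \<phi> \<cdot>\<^bsub>Y\<^esub> snd b' = snd b \<cdot>\<^bsub>Y\<^esub> f" by (rule B_homE[OF h])
    show ?thesis
      using sq by (simp add: h' \<rho>_def I_ar[OF \<phi>] A.Comp_Ide_left[OF \<phi>] A.Comp_Ide_right[OF \<phi>])
  qed
  have counit: "nat_trans B B (I \<odot> D) id_fctr \<rho>"
    by (intro nat_trans.intro nat_trans_axioms.intro is_functor_id category_B ID)
      (use \<rho>_hom nat in auto)
  have "\<rho> (ob I a) \<cdot>\<^bsub>B\<^esub> ar I (Ide A a) = Ide B (ob I a)" if "a \<in> Obj A" for a
    using that B.Comp_Ide_left[OF B.Ide_in_hom[OF I_Obj]] by (simp add: \<rho>_I I.ar_Ide)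
  moreover have "ar D (\<rho> b) \<cdot>\<^bsub>A\<^esub> Ide A (ob D b) = Ide A (ob D b)" if "b \<in> Obj B" for b
    using that A.Comp_Ide_left[OF A.Ide_in_hom] by (simp add: \<rho>_def B_Obj)
  ultimately show ?thesis
    by (intro adjunction.intro adjunction_axioms.intro functor_I functor_D unit counit)
qed

lemma T'_I: "fctr_eq A (T' \<odot> I) (inclusion_fctr \<odot> T)"
  by (auto simp: fctr_eq_def dest!: hom_DomCodI I_ar)

lemma T'_S': "fctr_eq Y (T' \<odot> S') id_fctr"
  by (auto simp: fctr_eq_def dest!: hom_DomCodI T'_S'_ar)

lemma D_I: "fctr_eq A (D \<odot> I) id_fctr"
  by (auto simp: fctr_eq_def dest!: hom_DomCodI I_ar)

lemma D_S': "fctr_eq Y (D \<odot> S') (S \<odot> E)"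
  by (auto simp: fctr_eq_def dest!: hom_DomCodI S'_ar)

section \<open>The canonical isomorphisms\<close>

definition \<gamma> :: "'x \<Rightarrow> ('a \<times> 'n) \<times> ('m \<times> 'n) \<times> ('a \<times> 'n)" where
  "\<gamma> x = ar S' (\<eta> x) \<cdot>\<^bsub>B\<^esub> \<epsilon>' (ob I (ob S x))"

lemma \<gamma>_factors:
  assumes x: "x \<in> Obj X"
  shows "\<epsilon>' (ob I (ob S x)) \<in> hom B (ob I (ob S x)) (ob_S' (ob T (ob S x)))"
    and "ar S' (\<eta> x) \<in> hom B (ob_S' (ob T (ob S x))) (ob_S' x)"
  using \<epsilon>'_hom[OF I_Obj[OF S_Obj[OF x]]] S'_hom[OF X_hom[OF \<eta>_hom[OF x]]] S_Obj[OF x] by auto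

lemma \<gamma>_hom: "x \<in> Obj X \<Longrightarrow> \<gamma> x \<in> hom B (ob I (ob S x)) (ob_S' x)"
  unfolding \<gamma>_def by (rule B.Comp_in_hom[OF \<gamma>_factors])

lemma T'_\<gamma>:
  assumes x: "x \<in> Obj X" shows "ar T' (\<gamma> x) = \<eta> x"
  using T'.ar_Comp[OF \<gamma>_factors[OF x]] T'_S'_ar[OF X_hom[OF \<eta>_hom[OF x]]]
    Y.Comp_Ide_left[OF X_hom[OF \<eta>_hom[OF x]]] S_Obj[OF x] by (simp add: \<gamma>_def)

lemma T'_\<gamma>_unit: "x \<in> Obj X \<Longrightarrow> ar T' (\<gamma> x) \<cdot>\<^bsub>Y\<^esub> Ide Y x = \<eta> x"
  using T'_\<gamma> Y.Comp_Ide_right[OF X_hom[OF \<eta>_hom]] by simp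

lemma \<gamma>_iso:
  assumes x: "x \<in> Obj X" shows "is_iso B (\<gamma> x)"
proof -
  obtain n where n: "n \<in> hom X (ob T (ob S x)) x" "n \<cdot>\<^bsub>X\<^esub> \<eta> x = Ide X x"
    "\<eta> x \<cdot>\<^bsub>X\<^esub> n = Ide X (ob T (ob S x))" by (rule is_isoE[OF \<eta>_iso[OF x] \<eta>_hom[OF x]])
  have "is_iso Y (\<eta> x)"
    using is_isoI[OF X_hom[OF \<eta>_hom[OF x]] X_hom[OF n(1)]] n X_Comp[OF \<eta>_hom[OF x] n(1)]
      X_Comp[OF n(1) \<eta>_hom[OF x]] X_Ide[OF x] X_Ide[OF T_Obj[OF S_Obj[OF x]]] by simp
  then have "is_iso B (ar S' (\<eta> x))"
    using S'.preserves_iso[of "\<eta> x"] X_hom[OF \<eta>_hom[OF x]] by simp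
  then show ?thesis
    unfolding \<gamma>_def
    using B.is_iso_Comp[OF \<epsilon>'_iso[OF I_Obj[OF S_Obj[OF x]]] \<gamma>_factors(1)[OF x] _ \<gamma>_factors(2)[OF x]] by simp
qed

lemma functor_inclusion: "is_functor X Y inclusion_fctr"
  by (rule reflection.R.is_functor_axioms)

lemma nat_iso_\<gamma>: "nat_iso (op_cat X) B (I \<odot> S) (S' \<odot> inclusion_fctr) \<gamma>"
proof -
  have nat: "ar (S' \<odot> inclusion_fctr) f \<cdot>\<^bsub>B\<^esub> \<gamma> x = \<gamma> z \<cdot>\<^bsub>B\<^esub> ar (I \<odot> S) f"
    if "f \<in> hom (op_cat X) x z" for f x z
  proof -
    have f: "f \<in> hom X z x" using that by simp
    have x: "x \<in> Obj X" and z: "z \<in> Obj X" using X.hom_Obj[OF f] by auto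
    note ISf = I.ar_in_hom[OF S_hom[OF f]] and S'f = S'_hom[OF X_hom[OF f]]
    have "ar S' f \<cdot>\<^bsub>B\<^esub> \<gamma> x = \<gamma> z \<cdot>\<^bsub>B\<^esub> ar I (ar S f)"
    proof (rule T'_faithful[OF B.Comp_in_hom[OF \<gamma>_hom[OF x] S'f] B.Comp_in_hom[OF ISf \<gamma>_hom[OF z]]])
      show "ar T' (ar S' f \<cdot>\<^bsub>B\<^esub> \<gamma> x) = ar T' (\<gamma> z \<cdot>\<^bsub>B\<^esub> ar I (ar S f))"
        using T'.ar_Comp[OF \<gamma>_hom[OF x] S'f] T'.ar_Comp[OF ISf \<gamma>_hom[OF z]] \<eta>_nat[OF f]
          X_Comp[OF f \<eta>_hom[OF x]] X_Comp[OF \<eta>_hom[OF z] T_hom[OF S_hom[OF f]]]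
        by (simp add: T'_\<gamma> x z T'_S'_ar[OF X_hom[OF f]] I_ar[OF S_hom[OF f]])
    qed
    then show ?thesis by simp
  qed
  show ?thesis
    by (intro nat_iso.intro nat_trans.intro nat_trans_axioms.intro nat_iso_axioms.intro
        is_functor_comp[OF duality.S.is_functor_axioms functor_I]
        is_functor_comp[OF is_functor_op[OF functor_inclusion] functor_S'])
      (use \<gamma>_hom \<gamma>_iso nat in auto)
qed

lemma \<gamma>_unique:
  assumes "nat_trans (op_cat X) B (I \<odot> S) (S' \<odot> inclusion_fctr) \<gamma>'" and x: "x \<in> Obj X"
    and eq: "ar T' (\<gamma>' x) \<cdot>\<^bsub>Y\<^esub> Ide Y x = \<eta> x"
  shows "\<gamma>' x = \<gamma> x"
proof -
  interpret nat_trans "op_cat X" B "I \<odot> S" "S' \<odot> inclusion_fctr" \<gamma>' by fact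
  have g: "\<gamma>' x \<in> hom B (ob I (ob S x)) (ob_S' x)" using component_in_hom x by simp
  have "ar T' (\<gamma>' x) \<in> hom Y x (ob T (ob S x))"
    using T'.ar_in_hom[OF g] X_Obj[OF x] S_Obj[OF x] by simp
  then show ?thesis
    using T'_faithful[OF g \<gamma>_hom[OF x]] T'_\<gamma>[OF x] eq Y.Comp_Ide_right by fastforce
qed

definition \<beta> :: "'a \<times> 'n \<Rightarrow> 'n" where
  "\<beta> b = ext (snd b)"

lemma functors_\<beta>:
  "is_functor (op_cat B) X (E \<odot> T')" "is_functor (op_cat B) X (T \<odot> D)"
  using is_functor_comp[OF is_functor_op[OF functor_T'], simplified, OF reflection.L.is_functor_axioms]
    is_functor_comp[OF is_functor_op[OF functor_D]
      is_functor_op[OF duality.T.is_functor_axioms, simplified]] by auto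

lemma nat_iso_\<beta>: "nat_iso (op_cat B) X (E \<odot> T') (T \<odot> D) \<beta>"
proof -
  have "ar (T \<odot> D) h \<cdot>\<^bsub>X\<^esub> \<beta> b' = \<beta> b \<cdot>\<^bsub>X\<^esub> ar (E \<odot> T') h" if "h \<in> hom (op_cat B) b' b" for h b b'
  proof -
    have h: "h \<in> hom B b b'" using that by simp
    obtain \<phi> f where h': "h = (b, (\<phi>, f), b')" by (rule B_homE[OF h])
    show ?thesis using B_ext_square h h' by (simp add: \<beta>_def)
  qed
  then show ?thesis
    by (intro nat_iso.intro nat_trans.intro nat_trans_axioms.intro nat_iso_axioms.intro functors_\<beta>)
      (use B_ext_hom B_ext_iso in \<open>auto simp: \<beta>_def\<close>)
qed

lemma \<beta>_S': "y \<in> Obj Y \<Longrightarrow> \<beta> (ob_S' y) = \<eta> (ob E y)"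
  by (simp add: \<beta>_def)

lemma S_\<beta>: "ar S (\<beta> b) \<cdot>\<^bsub>A\<^esub> \<epsilon> (fst b) = ar D (\<epsilon>' b)"
  by (simp add: \<beta>_def \<epsilon>'_def)

lemma \<beta>_unit: "b \<in> Obj B \<Longrightarrow> \<beta> b \<cdot>\<^bsub>Y\<^esub> \<iota> (Dom Y (snd b)) = ar T' (\<rho> b)"
  by (simp add: \<beta>_def B_ext_unit)

text \<open>This is naturality at \<open>\<epsilon>' b : b \<rightarrow> S' (T' b)\<close>, whose image under \<open>T'\<close> is an identity. Hence a
  natural transformation \<open>E T' \<rightarrow> T D\<close> is determined by its components at objects of the form
  \<open>S' y\<close>.\<close>

lemma \<beta>_component:
  assumes "nat_trans (op_cat B) X (E \<odot> T') (T \<odot> D) \<beta>'" and b: "b \<in> Obj B"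
  shows "\<beta>' b = ar T (ar D (\<epsilon>' b)) \<cdot>\<^bsub>X\<^esub> \<beta>' (ob_S' (Dom Y (snd b)))"
proof -
  interpret nat_trans "op_cat B" X "E \<odot> T'" "T \<odot> D" \<beta>' by fact
  have y: "Dom Y (snd b) \<in> Obj Y" using Y.hom_Obj[OF B_Obj_hom[OF b]] by simp
  have "\<beta>' b \<in> hom X (ob E (Dom Y (snd b))) (ob T (fst b))"
    using component_in_hom b by simp
  then show ?thesis
    using naturality[of "\<epsilon>' b"] \<epsilon>'_hom[OF b] X.Comp_Ide_right
    by (simp add: reflection.L.ar_Ide[OF y])
qed

lemma \<beta>_unique:
  assumes n: "nat_trans (op_cat B) X (E \<odot> T') (T \<odot> D) \<beta>'"
    and eq: "\<forall>y \<in> Obj Y. \<beta>' (ob_S' y) = \<eta> (ob E y)" and b: "b \<in> Obj B"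
  shows "\<beta>' b = \<beta> b"
proof -
  have "Dom Y (snd b) \<in> Obj Y" using Y.hom_Obj[OF B_Obj_hom[OF b]] by simp
  then show ?thesis
    using \<beta>_component[OF n b] \<beta>_component[OF nat_iso.axioms(1)[OF nat_iso_\<beta>] b] eq \<beta>_S' by simp
qed

text \<open>The second characterization is componentwise: \<open>\<epsilon>\<close> can be cancelled, and \<open>S\<close> is faithful.\<close>

lemma \<beta>_unique':
  assumes n: "nat_trans (op_cat B) X (E \<odot> T') (T \<odot> D) \<beta>'"
    and eq: "ar S (\<beta>' b) \<cdot>\<^bsub>A\<^esub> \<epsilon> (fst b) = ar D (\<epsilon>' b)" and b: "b \<in> Obj B"
  shows "\<beta>' b = \<beta> b"
proof -
  interpret nat_trans "op_cat B" X "E \<odot> T'" "T \<odot> D" \<beta>' by fact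
  have a: "fst b \<in> Obj A" using b by (simp add: B_Obj)
  have b': "\<beta>' b \<in> hom X (ob E (Dom Y (snd b))) (ob T (fst b))"
    using component_in_hom b by simp
  have \<beta>b: "\<beta> b \<in> hom X (ob E (Dom Y (snd b))) (ob T (fst b))"
    using B_ext_hom[OF b] by (simp add: \<beta>_def)
  have "ar S (\<beta>' b) = ar S (\<beta> b)"
    using A.iso_cancel_right[OF \<epsilon>_iso[OF a] \<epsilon>_hom[OF a] S_hom[OF b'] S_hom[OF \<beta>b]] eq S_\<beta> by simp
  then show ?thesis using S_faithful[OF b' \<beta>b] by simp
qed

text \<open>Over \<open>Y\<close> both sides are \<open>\<eta>\<^bsub>E y\<^esub> \<circ> \<iota>\<^bsub>y\<^esub>\<close>.\<close>

lemma \<rho>_S':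
  assumes y: "y \<in> Obj Y" shows "\<rho> (ob_S' y) = ar S' (\<iota> y) \<cdot>\<^bsub>B\<^esub> \<gamma> (ob E y)"
proof (rule T'_faithful)
  note g = \<gamma>_hom[OF E_Obj[OF y]] and s = S'_hom[OF \<iota>_hom[OF y]]
  show "\<rho> (ob_S' y) \<in> hom B (ob I (ob S (ob E y))) (ob_S' y)"
    using \<rho>_hom[OF ob_S'_Obj[OF y]] by simp
  show "ar S' (\<iota> y) \<cdot>\<^bsub>B\<^esub> \<gamma> (ob E y) \<in> hom B (ob I (ob S (ob E y))) (ob_S' y)"
    by (rule B.Comp_in_hom[OF g s])
  show "ar T' (\<rho> (ob_S' y)) = ar T' (ar S' (\<iota> y) \<cdot>\<^bsub>B\<^esub> \<gamma> (ob E y))"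
    using T'.ar_Comp[OF g s] T'_\<gamma>[OF E_Obj[OF y]] T'_S'_ar[OF \<iota>_hom[OF y]]
    by (simp add: ob_S'_def)
qed

end

theorem corollary3p10:
  fixes A :: "('a, 'm) cat" and X Y :: "('x, 'n) cat"
    and J E :: "('x, 'n, 'x, 'n) fctr" and \<iota> :: "'x \<Rightarrow> 'n"
    and T :: "('a, 'm, 'x, 'n) fctr" and S :: "('x, 'n, 'a, 'm) fctr"
    and \<eta> :: "'x \<Rightarrow> 'n" and \<epsilon> :: "'a \<Rightarrow> 'm"
    and B :: "('a \<times> 'n, ('a \<times> 'n) \<times> ('m \<times> 'n) \<times> ('a \<times> 'n)) cat"
    and I :: "('a, 'm, 'a \<times> 'n, ('a \<times> 'n) \<times> ('m \<times> 'n) \<times> ('a \<times> 'n)) fctr"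
  assumes sub: "full_subcategory X Y"
    and J: "J = inclusion_fctr"
    and refl: "\<exists>\<kappa>. adjunction Y X E J \<iota> \<kappa>"
    and dual: "dual_equivalence A X T S \<eta> \<epsilon>"
    and B: "B = D_cat A Y T (J_iota X Y E \<iota>)"
    and I: "I = I_fctr A X T"
  shows "full_embedding A B I \<and>
    (\<exists>T' S' \<eta>' \<epsilon>'.
      dual_equivalence B Y T' S' \<eta>' \<epsilon>' \<and>
      fctr_eq A (T' \<odot> I) (J \<odot> T) \<and>
      fctr_eq Y (T' \<odot> S') id_fctr \<and>
      (\<forall>y \<in> Obj Y. \<eta>' y = Ide Y y) \<and>
      (\<forall>b \<in> Obj B. ar T' (\<epsilon>' b) = Ide Y (ob T' b)) \<and>
      (\<forall>y \<in> Obj Y. \<epsilon>' (ob S' y) = Ide B (ob S' y)) \<and>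
      (\<exists>D \<rho>.
        (\<exists>\<upsilon>. adjunction A B I D \<upsilon> \<rho>) \<and>
        fctr_eq A (D \<odot> I) id_fctr \<and>
        (\<forall>a \<in> Obj A. \<rho> (ob I a) = Ide B (ob I a)) \<and>
        fctr_eq Y (D \<odot> S') (S \<odot> E) \<and>
        (\<exists>\<gamma> \<beta>.
          nat_iso (op_cat X) B (I \<odot> S) (S' \<odot> J) \<gamma> \<and>
          (\<forall>x \<in> Obj X. \<gamma> x = ar S' (ar J (\<eta> x)) \<cdot>\<^bsub>B\<^esub> \<epsilon>' (ob I (ob S x))) \<and>
          (\<forall>x \<in> Obj X. ar T' (\<gamma> x) \<cdot>\<^bsub>Y\<^esub> \<eta>' (ob J x) = ar J (\<eta> x)) \<and>
          (\<forall>\<gamma>'. nat_trans (op_cat X) B (I \<odot> S) (S' \<odot> J) \<gamma>' \<and>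
                (\<forall>x \<in> Obj X. ar T' (\<gamma>' x) \<cdot>\<^bsub>Y\<^esub> \<eta>' (ob J x) = ar J (\<eta> x))
              \<longrightarrow> (\<forall>x \<in> Obj X. \<gamma>' x = \<gamma> x)) \<and>
          nat_iso (op_cat B) X (E \<odot> T') (T \<odot> D) \<beta> \<and>
          (\<forall>y \<in> Obj Y. \<beta> (ob S' y) = \<eta> (ob E y)) \<and>
          (\<forall>b \<in> Obj B. ar S (\<beta> b) \<cdot>\<^bsub>A\<^esub> \<epsilon> (ob D b) = ar D (\<epsilon>' b)) \<and>
          (\<forall>\<beta>'. nat_trans (op_cat B) X (E \<odot> T') (T \<odot> D) \<beta>' \<and>
                (\<forall>y \<in> Obj Y. \<beta>' (ob S' y) = \<eta> (ob E y))
              \<longrightarrow> (\<forall>b \<in> Obj B. \<beta>' b = \<beta> b)) \<and>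
          (\<forall>\<beta>'. nat_trans (op_cat B) X (E \<odot> T') (T \<odot> D) \<beta>' \<and>
                (\<forall>b \<in> Obj B. ar S (\<beta>' b) \<cdot>\<^bsub>A\<^esub> \<epsilon> (ob D b) = ar D (\<epsilon>' b))
              \<longrightarrow> (\<forall>b \<in> Obj B. \<beta>' b = \<beta> b)) \<and>
          (\<forall>b \<in> Obj B. ar J (\<beta> b) \<cdot>\<^bsub>Y\<^esub> \<iota> (ob T' b) = ar T' (\<rho> b)) \<and>
          (\<forall>y \<in> Obj Y. \<rho> (ob S' y) = ar S' (\<iota> y) \<cdot>\<^bsub>B\<^esub> \<gamma> (ob E y)))))"
proof -
  obtain \<kappa> where "adjunction Y X E inclusion_fctr \<iota> \<kappa>" using refl J by blast
  then interpret reflection: adjunction Y X E inclusion_fctr \<iota> \<kappa> .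
  interpret duality: dual_equivalence A X T S \<eta> \<epsilon> by (rule dual)
  interpret duality_along_reflection A X Y E \<iota> \<kappa> T S \<eta> \<epsilon>
    by unfold_locales (rule sub)
  show ?thesis
    unfolding B I J
    \<comment> \<open>Since \<open>\<epsilon>'\<close> and \<open>\<rho>\<close> have the same type, the outer and the inner witnesses are supplied in
      two rounds.\<close>
    by (intro conjI full_embedding_I exI[of _ T'] exI[of _ S'] exI[of _ "\<lambda>y. Ide Y y"]
        exI[of _ \<epsilon>'] dual_equivalence_lift T'_I T'_S';
      (intro conjI exI[of _ D] exI[of _ \<rho>] exI[of _ "\<lambda>a. Ide A a"] exI[of _ \<gamma>] exI[of _ \<beta>]
        coreflection D_I D_S' nat_iso_\<gamma> nat_iso_\<beta>)?;
      auto simp: \<epsilon>'_S' \<rho>_I \<gamma>_def[symmetric] T'_\<gamma>_unit \<beta>_S' S_\<beta> \<rho>_S' \<beta>_unit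
        intro: \<gamma>_unique \<beta>_unique \<beta>_unique')
qed

end
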